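(* Let $\mathcal{L}$ be a finitely generated free Lie algebra over a field $F$ and let $B$ be a finitely generated Lie subalgebra of $\mathcal{L}$. Then $B$ is undistorted in $\mathcal{L}$.
   Context: The degree filtration $\{L_n\}_{n\ge 0}$ of a Lie algebra $L$ generated by a finite set $X$ is given by letting $L_n$ be the linear span of all Lie monomials (iterated commutators with arbitrary bracketing) of length at most $n$ in elements of $X$; $L_0=0$. A finitely generated subalgebra $B$ of a finitely generated Lie algebra $L$ is undistorted in $L$ if for degree filtrations $\{L_n\}$ of $L$ and $\{B_n\}$ of $B$ (defined by some finite generating sets; the property does not depend on their choice) there is an integer $t>0$ with $B_n\subset L_{tn}$ and $B\cap L_n\subset B_{tn}$ for all $n\ge 0$. *)

theory Defs
  imports Complex_Main
begin

section \<open>Lie algebras over a field\<close>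

locale lie_algebra = vector_space scale
  for scale :: "'f::field \<Rightarrow> 'a::ab_group_add \<Rightarrow> 'a" +
  fixes bracket :: "'a \<Rightarrow> 'a \<Rightarrow> 'a"
  assumes bracket_add_left: "bracket (x + y) z = bracket x z + bracket y z"
    and bracket_add_right: "bracket x (y + z) = bracket x y + bracket x z"
    and bracket_scale_left: "bracket (scale c x) y = scale c (bracket x y)"
    and bracket_scale_right: "bracket x (scale c y) = scale c (bracket x y)"
    and bracket_self: "bracket x x = 0"
    and jacobi: "bracket x (bracket y z) + bracket y (bracket z x) + bracket z (bracket x y) = 0"
begin

definition lie_subalgebra :: "'a set \<Rightarrow> bool" where
  "lie_subalgebra B \<longleftrightarrow> subspace B \<and> (\<forall>x\<in>B. \<forall>y\<in>B. bracket x y \<in> B)"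

definition generates :: "'a set \<Rightarrow> 'a set \<Rightarrow> bool" where
  "generates X B \<longleftrightarrow> lie_subalgebra hull X = B"

definition finitely_generated :: "'a set \<Rightarrow> bool" where
  "finitely_generated B \<longleftrightarrow> (\<exists>X. finite X \<and> generates X B)"

end


section \<open>Free Lie algebras\<close>

text \<open>
  A Lie algebra is free on a generating set \<open>X\<close> if the only relations among the elements
  of \<open>X\<close> are the consequences of the axioms of Lie algebras over the ground field, that is, if
  it is canonically the quotient of the algebra of formal Lie expressions in \<open>X\<close> by the congruence
  \<open>lie_equiv\<close> generated by those axioms. The lemmas \<open>free_on_extension\<close> and
  \<open>free_on_iff_extension\<close> below identify this with the universal property.
\<close>

datatype (dead 'f, gens: 'x) lie_term =
    Gen 'x
  | Zero
  | Add "('f, 'x) lie_term" "('f, 'x) lie_term"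
  | Scale 'f "('f, 'x) lie_term"
  | Bracket "('f, 'x) lie_term" "('f, 'x) lie_term"

inductive lie_equiv :: "('f::field, 'x) lie_term \<Rightarrow> ('f, 'x) lie_term \<Rightarrow> bool" where
  refl: "lie_equiv t t"
| sym: "lie_equiv s t \<Longrightarrow> lie_equiv t s"
| trans: "lie_equiv s t \<Longrightarrow> lie_equiv t u \<Longrightarrow> lie_equiv s u"
| cong_Add: "lie_equiv s s' \<Longrightarrow> lie_equiv t t' \<Longrightarrow> lie_equiv (Add s t) (Add s' t')"
| cong_Scale: "lie_equiv t t' \<Longrightarrow> lie_equiv (Scale c t) (Scale c t')"
| cong_Bracket: "lie_equiv s s' \<Longrightarrow> lie_equiv t t' \<Longrightarrow> lie_equiv (Bracket s t) (Bracket s' t')"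
| add_assoc: "lie_equiv (Add (Add s t) u) (Add s (Add t u))"
| add_commute: "lie_equiv (Add s t) (Add t s)"
| add_zero: "lie_equiv (Add Zero t) t"
| add_minus: "lie_equiv (Add (Scale (- 1) t) t) Zero"
| scale_add_right: "lie_equiv (Scale c (Add s t)) (Add (Scale c s) (Scale c t))"
| scale_add_left: "lie_equiv (Scale (c + d) t) (Add (Scale c t) (Scale d t))"
| scale_scale: "lie_equiv (Scale c (Scale d t)) (Scale (c * d) t)"
| scale_one: "lie_equiv (Scale 1 t) t"
| bracket_add_left: "lie_equiv (Bracket (Add s t) u) (Add (Bracket s u) (Bracket t u))"
| bracket_add_right: "lie_equiv (Bracket s (Add t u)) (Add (Bracket s t) (Bracket s u))"
| bracket_scale_left: "lie_equiv (Bracket (Scale c s) t) (Scale c (Bracket s t))"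
| bracket_scale_right: "lie_equiv (Bracket s (Scale c t)) (Scale c (Bracket s t))"
| bracket_self: "lie_equiv (Bracket t t) Zero"
| jacobi: "lie_equiv
    (Add (Add (Bracket s (Bracket t u)) (Bracket t (Bracket u s))) (Bracket u (Bracket s t))) Zero"

context lie_algebra
begin

primrec eval_term :: "('x \<Rightarrow> 'a) \<Rightarrow> ('f, 'x) lie_term \<Rightarrow> 'a" where
  "eval_term f (Gen x) = f x"
| "eval_term f Zero = 0"
| "eval_term f (Add s t) = eval_term f s + eval_term f t"
| "eval_term f (Scale c t) = scale c (eval_term f t)"
| "eval_term f (Bracket s t) = bracket (eval_term f s) (eval_term f t)"

definition free_on :: "'a set \<Rightarrow> bool" where
  "free_on X \<longleftrightarrow> generates X UNIV \<and>
    (\<forall>s t. gens s \<subseteq> X \<longrightarrow> gens t \<subseteq> X \<longrightarrow>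
      eval_term (\<lambda>x. x) s = eval_term (\<lambda>x. x) t \<longrightarrow> lie_equiv s t)"

definition free_lie_algebra :: bool where
  "free_lie_algebra \<longleftrightarrow> (\<exists>X. free_on X)"

end


section \<open>Degree filtrations and distortion\<close>

context lie_algebra
begin

inductive lie_monomial :: "'a set \<Rightarrow> nat \<Rightarrow> 'a \<Rightarrow> bool" for X where
  gen: "x \<in> X \<Longrightarrow> lie_monomial X 1 x"
| comm: "lie_monomial X m a \<Longrightarrow> lie_monomial X n b \<Longrightarrow> lie_monomial X (m + n) (bracket a b)"

definition degree_filtration :: "'a set \<Rightarrow> nat \<Rightarrow> 'a set" where
  "degree_filtration X n = span {a. \<exists>k\<le>n. lie_monomial X k a}"

text \<open>
  The existence of \<open>t\<close> does not depend on the finite generating sets; here it is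
  required for every choice of them, and \<open>finitely_generated\<close> ensures that there are some.
\<close>

definition undistorted :: "'a set \<Rightarrow> bool" where
  "undistorted B \<longleftrightarrow>
    finitely_generated UNIV \<and> lie_subalgebra B \<and> finitely_generated B \<and>
    (\<forall>X Y. finite X \<longrightarrow> generates X UNIV \<longrightarrow> finite Y \<longrightarrow> generates Y B \<longrightarrow>
      (\<exists>t>0. \<forall>n.
        degree_filtration Y n \<subseteq> degree_filtration X (t * n) \<and>
        B \<inter> degree_filtration X n \<subseteq> degree_filtration Y (t * n)))"

end


section \<open>The universal property of free Lie algebras\<close>

definition lie_hom where
  "lie_hom s1 b1 s2 b2 h \<longleftrightarrow>
    Vector_Spaces.linear s1 s2 h \<and> (\<forall>x y. h (b1 x y) = b2 (h x) (h y))"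

context lie_algebra
begin

lemma lie_subalgebra_hull: "lie_subalgebra (lie_subalgebra hull X)"
  by (rule hull_in) (auto simp: lie_subalgebra_def intro: subspace_Inter)

lemma eval_term_equiv: "lie_equiv s t \<Longrightarrow> eval_term f s = eval_term f t"
  by (induction rule: lie_equiv.induct)
    (simp_all add: ac_simps scale_right_distrib scale_left_distrib bracket_add_left
      bracket_add_right bracket_scale_left bracket_scale_right bracket_self
      jacobi[unfolded add.assoc])

lemma eval_term_surj:
  assumes "generates X UNIV"
  shows "\<exists>t. gens t \<subseteq> X \<and> eval_term (\<lambda>x. x) t = a"
proof -
  let ?E = "eval_term (\<lambda>x. x) ` {t. gens t \<subseteq> X}"
  have "lie_subalgebra ?E"
    unfolding lie_subalgebra_def
  proof (intro conjI subspaceI ballI)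
    show "0 \<in> ?E" by (rule image_eqI[of _ _ Zero]) auto
  next
    fix x y assume "x \<in> ?E" "y \<in> ?E"
    then obtain s t where st: "gens s \<subseteq> X" "gens t \<subseteq> X"
      "x = eval_term (\<lambda>x. x) s" "y = eval_term (\<lambda>x. x) t" by auto
    show "x + y \<in> ?E" by (rule image_eqI[of _ _ "Add s t"]) (use st in auto)
    show "bracket x y \<in> ?E" by (rule image_eqI[of _ _ "Bracket s t"]) (use st in auto)
  next
    fix c x assume "x \<in> ?E"
    then obtain s where st: "gens s \<subseteq> X" "x = eval_term (\<lambda>x. x) s" by auto
    show "scale c x \<in> ?E" by (rule image_eqI[of _ _ "Scale c s"]) (use st in auto)
  qed
  moreover have "X \<subseteq> ?E"
  proof
    fix x assume "x \<in> X"
    then show "x \<in> ?E" by (intro image_eqI[of _ _ "Gen x"]) auto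
  qed
  ultimately have "lie_subalgebra hull X \<subseteq> ?E" by (intro hull_minimal)
  then have "a \<in> ?E" using assms by (auto simp: generates_def)
  then show ?thesis by auto
qed

lemma hom_eval_term:
  assumes "lie_algebra scale2 bracket2" and h: "lie_hom scale bracket scale2 bracket2 h"
    and "\<forall>x\<in>gens t. h (g x) = f x"
  shows "h (eval_term g t) = lie_algebra.eval_term scale2 bracket2 f t"
proof -
  interpret L: lie_algebra scale2 bracket2 by fact
  interpret H: Vector_Spaces.linear scale scale2 h using h by (simp add: lie_hom_def)
  show ?thesis using assms(3) h
    by (induction t) (auto simp: H.add H.scale H.zero lie_hom_def)
qed

lemma free_on_extension:
  fixes scale2 :: "'f \<Rightarrow> 'b::ab_group_add \<Rightarrow> 'b"
  assumes X: "free_on X" and L2: "lie_algebra scale2 bracket2"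
  shows "\<exists>!h. lie_hom scale bracket scale2 bracket2 h \<and> (\<forall>x\<in>X. h x = f x)"
proof -
  interpret L: lie_algebra scale2 bracket2 by fact
  let ?ev = "eval_term (\<lambda>x. x)"
  have gen: "generates X UNIV" using X by (simp add: free_on_def)
  define rep where "rep a = (SOME t. gens t \<subseteq> X \<and> ?ev t = a)" for a
  have rep: "gens (rep a) \<subseteq> X" "?ev (rep a) = a" for a
    using someI_ex[OF eval_term_surj[OF gen, of a]] by (auto simp: rep_def)
  define h where "h a = L.eval_term f (rep a)" for a
  have h: "h (?ev t) = L.eval_term f t" if "gens t \<subseteq> X" for t
  proof -
    have "lie_equiv (rep (?ev t)) t" using X rep that by (auto simp: free_on_def)
    then show ?thesis unfolding h_def by (rule L.eval_term_equiv)
  qed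
  have "h (x + y) = h x + h y" for x y
    using h[of "Add (rep x) (rep y)"] rep by (simp add: h_def)
  moreover have "h (scale c x) = scale2 c (h x)" for c x
    using h[of "Scale c (rep x)"] rep by (simp add: h_def)
  moreover have "h (bracket x y) = bracket2 (h x) (h y)" for x y
    using h[of "Bracket (rep x) (rep y)"] rep by (simp add: h_def)
  moreover have "h x = f x" if "x \<in> X" for x
    using h[of "Gen x"] that by simp
  ultimately have "lie_hom scale bracket scale2 bracket2 h \<and> (\<forall>x\<in>X. h x = f x)"
    by (simp add: lie_hom_def Vector_Spaces.linear_iff L.vector_space_axioms vector_space_axioms)
  moreover have "k = h" if k: "lie_hom scale bracket scale2 bracket2 k" "\<forall>x\<in>X. k x = f x" for k
  proof
    fix a
    show "k a = h a"
      using hom_eval_term[OF L2 k(1), of "rep a" "\<lambda>x. x" f] rep[of a] k(2) by (auto simp: h_def)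
  qed
  ultimately show ?thesis by blast
qed

end

text \<open>The quotient of all formal Lie expressions by \<open>lie_equiv\<close> is itself a Lie algebra.\<close>

quotient_type (overloaded) ('f, 'x) free_lie = "('f::field, 'x) lie_term" / lie_equiv
  by (rule equivpI)
    (blast intro: reflpI sympI transpI lie_equiv.refl lie_equiv.sym lie_equiv.trans)+

lift_definition free_gen :: "'x \<Rightarrow> ('f::field, 'x) free_lie" is Gen .

lift_definition free_scale :: "'f::field \<Rightarrow> ('f, 'x) free_lie \<Rightarrow> ('f, 'x) free_lie" is Scale
  by (rule lie_equiv.cong_Scale)

lift_definition free_bracket ::
    "('f::field, 'x) free_lie \<Rightarrow> ('f, 'x) free_lie \<Rightarrow> ('f, 'x) free_lie" is Bracket
  by (rule lie_equiv.cong_Bracket)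

instantiation free_lie :: (field, type) ab_group_add
begin

lift_definition zero_free_lie :: "('a, 'b) free_lie" is Zero .

lift_definition plus_free_lie :: "('a, 'b) free_lie \<Rightarrow> ('a, 'b) free_lie \<Rightarrow> ('a, 'b) free_lie"
  is Add by (rule lie_equiv.cong_Add)

definition uminus_free_lie :: "('a, 'b) free_lie \<Rightarrow> ('a, 'b) free_lie" where
  "- a = free_scale (- 1) a"

definition minus_free_lie :: "('a, 'b) free_lie \<Rightarrow> ('a, 'b) free_lie \<Rightarrow> ('a, 'b) free_lie" where
  "a - b = a + - (b :: ('a, 'b) free_lie)"

instance
proof
  fix a b c :: "('a, 'b) free_lie"
  show "a + b + c = a + (b + c)" by transfer (rule lie_equiv.add_assoc)
  show "a + b = b + a" by transfer (rule lie_equiv.add_commute)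
  show "0 + a = a" by transfer (rule lie_equiv.add_zero)
  show "- a + a = 0" unfolding uminus_free_lie_def by transfer (rule lie_equiv.add_minus)
  show "a - b = a + - b" by (rule minus_free_lie_def)
qed

end

interpretation free_lie: lie_algebra free_scale free_bracket
proof
  fix a b :: 'a and x y z :: "('a, 'b) free_lie"
  show "free_scale a (x + y) = free_scale a x + free_scale a y"
    by transfer (rule lie_equiv.scale_add_right)
  show "free_scale (a + b) x = free_scale a x + free_scale b x"
    by transfer (rule lie_equiv.scale_add_left)
  show "free_scale a (free_scale b x) = free_scale (a * b) x"
    by transfer (rule lie_equiv.scale_scale)
  show "free_scale 1 x = x" by transfer (rule lie_equiv.scale_one)
  show "free_bracket (x + y) z = free_bracket x z + free_bracket y z"
    by transfer (rule lie_equiv.bracket_add_left)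
  show "free_bracket x (y + z) = free_bracket x y + free_bracket x z"
    by transfer (rule lie_equiv.bracket_add_right)
  show "free_bracket (free_scale a x) y = free_scale a (free_bracket x y)"
    by transfer (rule lie_equiv.bracket_scale_left)
  show "free_bracket x (free_scale a y) = free_scale a (free_bracket x y)"
    by transfer (rule lie_equiv.bracket_scale_right)
  show "free_bracket x x = 0" by transfer (rule lie_equiv.bracket_self)
  show "free_bracket x (free_bracket y z) + free_bracket y (free_bracket z x) +
      free_bracket z (free_bracket x y) = 0"
    by transfer (rule lie_equiv.jacobi)
qed

lemma eval_term_free_gen:
  "free_lie.eval_term free_gen t = abs_free_lie t"
  by (induction t)
    (simp_all add: free_gen.abs_eq zero_free_lie.abs_eq plus_free_lie.abs_eq
      free_scale.abs_eq free_bracket.abs_eq)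

lemma (in lie_algebra) free_on_iff_extension:
  "free_on X \<longleftrightarrow> generates X UNIV \<and>
    (\<forall>f :: 'a \<Rightarrow> ('f, 'a) free_lie.
      \<exists>!h. lie_hom scale bracket free_scale free_bracket h \<and> (\<forall>x\<in>X. h x = f x))"
  (is "_ \<longleftrightarrow> _ \<and> ?U")
proof
  assume "free_on X"
  then show "generates X UNIV \<and> ?U"
    by (intro conjI allI free_on_extension free_lie.lie_algebra_axioms) (auto simp: free_on_def)
next
  assume *: "generates X UNIV \<and> ?U"
  then obtain h :: "'a \<Rightarrow> ('f, 'a) free_lie"
    where h: "lie_hom scale bracket free_scale free_bracket h" "\<forall>x\<in>X. h x = free_gen x"
    by metis
  have "h (eval_term (\<lambda>x. x) t) = abs_free_lie t" if "gens t \<subseteq> X" for t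
    using hom_eval_term[OF free_lie.lie_algebra_axioms h(1), of t "\<lambda>x. x" free_gen] h(2) that
    by (auto simp: eval_term_free_gen)
  then show "free_on X"
    using * unfolding free_on_def by (metis free_lie.abs_eq_iff)
qed

lemma eval_term_map:
  "free_lie.eval_term (\<lambda>x. x) (map_lie_term free_gen t) = abs_free_lie t"
  by (induction t)
    (simp_all add: free_gen.abs_eq zero_free_lie.abs_eq plus_free_lie.abs_eq
      free_scale.abs_eq free_bracket.abs_eq)

lemma lie_equiv_map: "lie_equiv s t \<Longrightarrow> lie_equiv (map_lie_term g s) (map_lie_term g t)"
proof (induction rule: lie_equiv.induct)
  case (sym s t)
  then show ?case by (blast intro: lie_equiv.sym)
next
  case (trans s t u)
  then show ?case by (blast intro: lie_equiv.trans)
qed (simp_all add: lie_equiv.intros(1,4-))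

lemma gens_subset_range:
  "gens t \<subseteq> range g \<Longrightarrow> \<exists>u. t = map_lie_term g u"
proof (induction t)
  case (Gen x)
  then obtain y where "x = g y" by auto
  then have "Gen x = map_lie_term g (Gen y)" by simp
  then show ?case by (rule exI)
next
  case Zero
  have "Zero = map_lie_term g Zero" by simp
  then show ?case by (rule exI)
next
  case (Add s t)
  then obtain u v where "s = map_lie_term g u" "t = map_lie_term g v" by auto
  then have "Add s t = map_lie_term g (Add u v)" by simp
  then show ?case by (rule exI)
next
  case (Scale c t)
  then obtain u where "t = map_lie_term g u" by auto
  then have "Scale c t = map_lie_term g (Scale c u)" by simp
  then show ?case by (rule exI)
next
  case (Bracket s t)
  then obtain u v where "s = map_lie_term g u" "t = map_lie_term g v" by auto
  then have "Bracket s t = map_lie_term g (Bracket u v)" by simp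
  then show ?case by (rule exI)
qed

lemma free_lie_generates:
  "free_lie.generates (range free_gen :: ('f::field, 'x) free_lie set) UNIV"
proof -
  let ?H = "free_lie.lie_subalgebra hull (range free_gen :: ('f, 'x) free_lie set)"
  have H: "free_lie.subspace ?H" "\<And>x y. x \<in> ?H \<Longrightarrow> y \<in> ?H \<Longrightarrow> free_bracket x y \<in> ?H"
    using free_lie.lie_subalgebra_hull[of "range free_gen :: ('f, 'x) free_lie set"]
    by (auto simp: free_lie.lie_subalgebra_def)
  have "abs_free_lie t \<in> ?H" for t
  proof (induction t)
    case (Gen x)
    then show ?case using hull_subset[of "range free_gen :: ('f, 'x) free_lie set"]
      by (auto simp flip: free_gen.abs_eq)
  qed (auto simp flip: zero_free_lie.abs_eq plus_free_lie.abs_eq free_scale.abs_eq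
      free_bracket.abs_eq intro: H(2) free_lie.subspace_0[OF H(1)] free_lie.subspace_add[OF H(1)]
      free_lie.subspace_scale[OF H(1)])
  then have "a \<in> ?H" for a by (induction a rule: free_lie.abs_induct) simp
  then show ?thesis unfolding free_lie.generates_def by blast
qed

lemma free_lie_free_on: "free_lie.free_on (range free_gen :: ('f::field, 'x) free_lie set)"
  unfolding free_lie.free_on_def
proof (intro conjI allI impI)
  show "free_lie.generates (range free_gen :: ('f, 'x) free_lie set) UNIV"
    by (rule free_lie_generates)
next
  fix s t :: "('f, ('f, 'x) free_lie) lie_term"
  assume "gens s \<subseteq> range free_gen" "gens t \<subseteq> range free_gen"
    and eq: "free_lie.eval_term (\<lambda>x. x) s = free_lie.eval_term (\<lambda>x. x) t"
  then obtain u v :: "('f, 'x) lie_term"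
    where uv: "s = map_lie_term free_gen u" "t = map_lie_term free_gen v"
    by (metis gens_subset_range)
  then have "lie_equiv u v" using eq by (simp add: eval_term_map free_lie.abs_eq_iff)
  then show "lie_equiv s t" unfolding uv by (rule lie_equiv_map)
qed

end

theory Submission
  imports Defs "HOL-Library.Product_Plus" "HOL-Library.Function_Algebras"
begin

text \<open>
  Bounding lengths in \<open>X\<close> by lengths in \<open>Y\<close> is immediate: express each generator of the subalgebra
  \<open>B\<close> in the generators of the algebra. Moreover all finite generating sets of an algebra give
  comparable filtrations (\<open>degree_filtration_compare\<close>), so it is enough to find one finite generating
  set \<open>Y\<close> of \<open>B\<close> such that every element of \<open>B\<close> of degree \<open>n\<close> with respect to free generators \<open>X\<close> of
  the algebra is a combination of monomials of length at most \<open>n\<close> in \<open>Y\<close>.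

  A free Lie algebra is graded by degree in \<open>X\<close> (\<open>free_grading\<close>). The only obstruction to
  the above is cancellation: an expression in \<open>Y\<close> may have small degree although it contains long
  monomials, if its terms of top weight cancel. Cancellation is a relation among the leading components of
  the elements of \<open>Y\<close>. Choose \<open>Y\<close> finite with the smallest sum of degrees. Then no leading component
  is generated by the others (\<open>exists_reduced_generators\<close>). By the Shirshov-Witt theorem for
  homogeneous elements (\<open>lie_indep_homogeneous\<close>) the leading components then satisfy no relations, and
  \<open>Y\<close> is as required (\<open>exists_strict_generators\<close>).

  The Shirshov-Witt theorem is proved by Lazard elimination: if \<open>Z\<close> generates freely and \<open>z0\<close> is one of
  its elements, the kernel of a Lie homomorphism to the ground field with value \<open>1\<close> at \<open>z0\<close> is
  freely generated by explicit elements (\<open>lie_indep_elimination\<close>). Repeated elimination shrinks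
  the ambient free algebra until it agrees with the given graded subalgebra in all relevant degrees
  (\<open>lie_indep_reduction\<close>); there the given homogeneous generators are exchanged into a free
  generating set (\<open>lie_indep_exchange\<close>).
\<close>

section \<open>Lie subalgebras generated by a set\<close>

definition lie_hom_on where
  "lie_hom_on s1 b1 s2 b2 C h \<longleftrightarrow>
    (\<forall>x\<in>C. \<forall>y\<in>C. h (x + y) = h x + h y \<and> h (b1 x y) = b2 (h x) (h y)) \<and>
    (\<forall>c. \<forall>x\<in>C. h (s1 c x) = s2 c (h x))"

lemma lie_hom_onD:
  assumes "lie_hom_on s1 b1 s2 b2 C h" "x \<in> C"
  shows lie_hom_on_add: "y \<in> C \<Longrightarrow> h (x + y) = h x + h y"
    and lie_hom_on_bracket: "y \<in> C \<Longrightarrow> h (b1 x y) = b2 (h x) (h y)"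
    and lie_hom_on_scale: "h (s1 c x) = s2 c (h x)"
  using assms unfolding lie_hom_on_def by blast+

context lie_algebra
begin

abbreviation lie_span :: "'a set \<Rightarrow> 'a set" where
  "lie_span X \<equiv> lie_subalgebra hull X"

lemma bracket_0_left [simp]: "bracket 0 x = 0"
  using bracket_add_left[of 0 0 x] by simp

lemma bracket_0_right [simp]: "bracket x 0 = 0"
  using bracket_add_right[of x 0 0] by simp

lemma bracket_sum_right: "bracket y (\<Sum>i\<in>I. f i) = (\<Sum>i\<in>I. bracket y (f i))"
  by (induction I rule: infinite_finite_induct) (simp_all add: bracket_add_right)

lemma bracket_anticommute: "bracket y x = - bracket x y"
proof -
  have "bracket (x + y) (x + y) = bracket x y + bracket y x"
    by (simp add: bracket_add_left bracket_add_right bracket_self[of x] bracket_self[of y]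
        add.commute)
  then have "bracket y x + bracket x y = 0"
    unfolding bracket_self by (simp add: add.commute)
  then show ?thesis
    by (simp add: eq_neg_iff_add_eq_0)
qed

lemma bracket_minus_right: "bracket x (- y) = - bracket x y"
  using bracket_add_right[of x y "- y"] by (simp add: eq_neg_iff_add_eq_0 add.commute)

lemma bracket_derivation:
  "bracket z (bracket x y) = bracket (bracket z x) y + bracket x (bracket z y)"
  using jacobi[of z x y] bracket_anticommute[of "bracket z x" y]
    bracket_anticommute[of z y]
  by (simp add: bracket_minus_right algebra_simps add_eq_0_iff)

lemma lie_subalgebra_subspace: "lie_subalgebra C \<Longrightarrow> subspace C"
  by (simp add: lie_subalgebra_def)

lemma lie_subalgebra_bracket: "lie_subalgebra C \<Longrightarrow> x \<in> C \<Longrightarrow> y \<in> C \<Longrightarrow> bracket x y \<in> C"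
  by (simp add: lie_subalgebra_def)

lemmas lie_span_subspace [simp, intro] = lie_subalgebra_subspace[OF lie_subalgebra_hull]
lemmas lie_span_bracket = lie_subalgebra_bracket[OF lie_subalgebra_hull]

lemma lie_span_base: "x \<in> X \<Longrightarrow> x \<in> lie_span X"
  by (rule hull_inc)

lemma lie_span_least: "X \<subseteq> lie_span Y \<Longrightarrow> lie_span X \<subseteq> lie_span Y"
  by (rule hull_minimal) (auto intro: lie_subalgebra_hull)

lemma span_subset_lie_span: "X \<subseteq> lie_span Y \<Longrightarrow> span X \<subseteq> lie_span Y"
  by (rule span_minimal) auto

lemma lie_span_induct [consumes 1, case_names base zero add scale bracket]:
  assumes "a \<in> lie_span X" and "\<And>x. x \<in> X \<Longrightarrow> Q x" and "Q 0"
    and "\<And>x y. x \<in> lie_span X \<Longrightarrow> y \<in> lie_span X \<Longrightarrow> Q x \<Longrightarrow> Q y \<Longrightarrow> Q (x + y)"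
    and "\<And>c x. x \<in> lie_span X \<Longrightarrow> Q x \<Longrightarrow> Q (scale c x)"
    and "\<And>x y. x \<in> lie_span X \<Longrightarrow> y \<in> lie_span X \<Longrightarrow> Q x \<Longrightarrow> Q y \<Longrightarrow> Q (bracket x y)"
  shows "Q a"
proof -
  have "subspace {x \<in> lie_span X. Q x}"
    using assms(3-5) by (intro subspaceI)
      (auto intro: subspace_0 subspace_add subspace_scale)
  then have "lie_subalgebra {x \<in> lie_span X. Q x}"
    using assms(6) lie_span_bracket by (subst lie_subalgebra_def) blast
  then have "lie_span X \<subseteq> {x \<in> lie_span X. Q x}"
    by (intro hull_minimal) (auto intro: assms(2) lie_span_base)
  then show ?thesis using assms(1) by blast
qed

lemma eval_term_cong: "(\<And>x. x \<in> gens t \<Longrightarrow> f x = g x) \<Longrightarrow> eval_term f t = eval_term g t"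
  by (induction t) auto

lemma eval_term_in_subalgebra:
  "lie_subalgebra C \<Longrightarrow> f ` gens t \<subseteq> C \<Longrightarrow> eval_term f t \<in> C"
  by (induction t)
    (auto intro: subspace_0 subspace_add subspace_scale lie_subalgebra_bracket
      lie_subalgebra_subspace)

lemma eval_term_in_lie_span:
  "gens t \<subseteq> X \<Longrightarrow> eval_term (\<lambda>x. x) t \<in> lie_span X"
  by (rule eval_term_in_subalgebra[OF lie_subalgebra_hull]) (auto intro: lie_span_base)

lemma lie_span_obtain_term:
  assumes "a \<in> lie_span X"
  shows "\<exists>t. gens t \<subseteq> X \<and> eval_term (\<lambda>x. x) t = a"
  using assms
proof (induction a rule: lie_span_induct)
  case (base x)
  then show ?case by (intro exI[of _ "Gen x"]) auto
next
  case zero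
  show ?case by (intro exI[of _ Zero]) auto
next
  case (add x y)
  then obtain s t where "gens s \<subseteq> X" "gens t \<subseteq> X"
    "eval_term (\<lambda>x. x) s = x" "eval_term (\<lambda>x. x) t = y" by blast
  then show ?case by (intro exI[of _ "Add s t"]) auto
next
  case (scale c x)
  then obtain s where "gens s \<subseteq> X" "eval_term (\<lambda>x. x) s = x" by blast
  then show ?case by (intro exI[of _ "Scale c s"]) auto
next
  case (bracket x y)
  then obtain s t where "gens s \<subseteq> X" "gens t \<subseteq> X"
    "eval_term (\<lambda>x. x) s = x" "eval_term (\<lambda>x. x) t = y" by blast
  then show ?case by (intro exI[of _ "Bracket s t"]) auto
qed

lemma hom_on_eval_term:
  assumes "lie_algebra scale2 bracket2" and C: "lie_subalgebra C"
    and h: "lie_hom_on scale bracket scale2 bracket2 C h"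
    and "f ` gens t \<subseteq> C"
  shows "h (eval_term f t) = lie_algebra.eval_term scale2 bracket2 (\<lambda>x. h (f x)) t"
proof -
  interpret L: lie_algebra scale2 bracket2 by fact
  have 0: "h 0 = 0"
  proof -
    have "0 \<in> C" using C by (simp add: lie_subalgebra_subspace subspace_0)
    then have "h (0 + 0) = h 0 + h 0" using h by (simp only: lie_hom_on_def)
    then show ?thesis by simp
  qed
  show ?thesis using assms(4)
  proof (induction t)
    case (Add s t)
    then have "eval_term f s \<in> C" "eval_term f t \<in> C"
      by (auto intro!: eval_term_in_subalgebra[OF C])
    with Add h show ?case by (simp add: lie_hom_on_def image_Un)
  next
    case (Scale c t)
    then have "eval_term f t \<in> C"
      by (auto intro!: eval_term_in_subalgebra[OF C])
    with Scale h show ?case by (simp add: lie_hom_on_def)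
  next
    case (Bracket s t)
    then have "eval_term f s \<in> C" "eval_term f t \<in> C"
      by (auto intro!: eval_term_in_subalgebra[OF C])
    with Bracket h show ?case by (simp add: lie_hom_on_def image_Un)
  qed (simp_all add: 0)
qed

section \<open>Sets without relations\<close>

text \<open>
  \<open>lie_indep Z\<close> says that \<open>Z\<close> freely generates the Lie subalgebra \<open>lie_span Z\<close>. Being
  a property of \<open>Z\<close> alone, it can be passed to subsets and transported between subalgebras.
\<close>

definition lie_indep :: "'a set \<Rightarrow> bool" where
  "lie_indep Z \<longleftrightarrow> (\<forall>s t. gens s \<subseteq> Z \<longrightarrow> gens t \<subseteq> Z \<longrightarrow>
      eval_term (\<lambda>x. x) s = eval_term (\<lambda>x. x) t \<longrightarrow> lie_equiv s t)"

lemma free_on_iff: "free_on X \<longleftrightarrow> lie_span X = UNIV \<and> lie_indep X"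
  by (simp add: free_on_def lie_indep_def generates_def)

lemma lie_indep_mono: "lie_indep Z \<Longrightarrow> Y \<subseteq> Z \<Longrightarrow> lie_indep Y"
  unfolding lie_indep_def by (meson subset_trans)

text \<open>
  The universal property of \<open>lie_span Z\<close>: a relation-free element has a well-defined value under
  every substitution, because formal expressions that agree in the algebra agree formally.
\<close>

lemma lie_indep_extension:
  fixes scale2 :: "'f \<Rightarrow> 'b::ab_group_add \<Rightarrow> 'b"
  assumes Z: "lie_indep Z" and L2: "lie_algebra scale2 bracket2"
  obtains h where "lie_hom_on scale bracket scale2 bracket2 (lie_span Z) h"
    and "\<And>z. z \<in> Z \<Longrightarrow> h z = g z"
proof -
  interpret L: lie_algebra scale2 bracket2 by fact
  let ?ev = "eval_term (\<lambda>x. x)"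
  define rep where "rep a = (SOME t. gens t \<subseteq> Z \<and> ?ev t = a)" for a
  have rep: "gens (rep a) \<subseteq> Z" "?ev (rep a) = a" if "a \<in> lie_span Z" for a
    using someI_ex[OF lie_span_obtain_term[OF that]] by (auto simp: rep_def)
  define h where "h a = L.eval_term g (rep a)" for a
  have h: "h (?ev t) = L.eval_term g t" if t: "gens t \<subseteq> Z" for t
  proof -
    have "?ev t \<in> lie_span Z"
      using t by (rule eval_term_in_lie_span)
    then have "lie_equiv (rep (?ev t)) t" using Z rep t by (auto simp: lie_indep_def)
    then show ?thesis unfolding h_def by (rule L.eval_term_equiv)
  qed
  show ?thesis
  proof (rule that)
    show "lie_hom_on scale bracket scale2 bracket2 (lie_span Z) h"
      unfolding lie_hom_on_def
    proof (intro conjI ballI allI)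
      fix x y assume xy: "x \<in> lie_span Z" "y \<in> lie_span Z"
      show "h (x + y) = h x + h y"
        using h[of "Add (rep x) (rep y)"] rep xy by (simp add: h_def)
      show "h (bracket x y) = bracket2 (h x) (h y)"
        using h[of "Bracket (rep x) (rep y)"] rep xy by (simp add: h_def)
    next
      fix c x assume "x \<in> lie_span Z"
      then show "h (scale c x) = scale2 c (h x)"
        using h[of "Scale c (rep x)"] rep by (simp add: h_def)
    qed
    show "h z = g z" if "z \<in> Z" for z
      using h[of "Gen z"] that by simp
  qed
qed

text \<open>
  The converse, with the free algebra as the only test object: relations among the \<open>z\<close> are mapped to
  relations among free generators. All relation-free sets below are recognized in this way.
\<close>

lemma lie_indepI:
  assumes C: "lie_subalgebra C"
    and h: "lie_hom_on scale bracket free_scale free_bracket C h"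
    and Z: "Z \<subseteq> C" "\<And>z. z \<in> Z \<Longrightarrow> h z = free_gen z"
  shows "lie_indep Z"
  unfolding lie_indep_def
proof (intro allI impI)
  have *: "h (eval_term (\<lambda>x. x) t) = abs_free_lie t" if "gens t \<subseteq> Z" for t
  proof -
    have "h (eval_term (\<lambda>x. x) t) = free_lie.eval_term h t"
      using that Z(1) by (subst hom_on_eval_term[OF free_lie.lie_algebra_axioms C h]) auto
    also have "\<dots> = free_lie.eval_term free_gen t"
      using that Z(2) by (intro free_lie.eval_term_cong) auto
    finally show ?thesis by (simp add: eval_term_free_gen)
  qed
  fix s t assume "gens s \<subseteq> Z" "gens t \<subseteq> Z" "eval_term (\<lambda>x. x) s = eval_term (\<lambda>x. x) t"
  then have "abs_free_lie s = abs_free_lie t" using * by metis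
  then show "lie_equiv s t" by (simp add: free_lie.abs_eq_iff)
qed

lemma hom_on_agree:
  assumes L2: "lie_algebra scale2 bracket2"
    and h: "lie_hom_on scale bracket scale2 bracket2 (lie_span X) h"
    and k: "lie_hom_on scale bracket scale2 bracket2 (lie_span X) k"
    and "\<And>x. x \<in> X \<Longrightarrow> h x = k x" and "a \<in> lie_span X"
  shows "h a = k a"
proof -
  interpret L: lie_algebra scale2 bracket2 by fact
  obtain t where t: "gens t \<subseteq> X" "a = eval_term (\<lambda>x. x) t"
    using lie_span_obtain_term assms(5) by blast
  have X: "(\<lambda>x. x) ` gens t \<subseteq> lie_span X" using t(1) lie_span_base by auto
  show ?thesis unfolding t(2)
    using hom_on_eval_term[OF L2 lie_subalgebra_hull h X]
      hom_on_eval_term[OF L2 lie_subalgebra_hull k X] t(1) assms(4)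
    by (auto intro: L.eval_term_cong)
qed

lemma lie_hom_on_subset:
  "lie_hom_on s1 b1 s2 b2 C h \<Longrightarrow> C' \<subseteq> C \<Longrightarrow> lie_hom_on s1 b1 s2 b2 C' h"
  unfolding lie_hom_on_def by blast

lemma lie_span_exchange:
  assumes "z0 \<in> Z" "c \<noteq> 0" "q \<in> lie_span (Z - {z0})" and h: "h = scale c z0 + q"
  shows "lie_span (insert h (Z - {z0})) = lie_span Z"
proof
  have q: "q \<in> lie_span Z"
    using assms(3) hull_mono[of "Z - {z0}" Z lie_subalgebra] by blast
  show "lie_span (insert h (Z - {z0})) \<subseteq> lie_span Z"
    using assms(1) q by (intro lie_span_least)
      (auto simp: h intro!: subspace_add[of "lie_span Z"] subspace_scale[of "lie_span Z"]
          intro: lie_span_base)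
  have q': "q \<in> lie_span (insert h (Z - {z0}))"
    using assms(3) hull_mono[of "Z - {z0}" "insert h (Z - {z0})" lie_subalgebra] by blast
  have "z0 = scale (inverse c) (h - q)"
    using assms(2) by (simp add: h)
  moreover have "scale (inverse c) (h - q) \<in> lie_span (insert h (Z - {z0}))"
    using q' by (auto intro!: subspace_scale subspace_diff intro: lie_span_base)
  ultimately have "z0 \<in> lie_span (insert h (Z - {z0}))" by simp
  then show "lie_span Z \<subseteq> lie_span (insert h (Z - {z0}))"
    by (intro lie_span_least) (auto intro: lie_span_base)
qed

text \<open>
  An elementary (Nielsen) transformation. Sending \<open>z0\<close> to \<open>c\<inverse> (h - q)\<close>, with \<open>h\<close> a new free
  generator, sends the actual element \<open>h = c z0 + q\<close> to that generator.
\<close>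

lemma lie_indep_exchange:
  assumes Z: "lie_indep Z" "z0 \<in> Z" and c: "c \<noteq> 0" and q: "q \<in> lie_span (Z - {z0})"
    and h: "h = scale c z0 + q"
  shows "lie_indep (insert h (Z - {z0}))"
proof -
  note FL = free_lie.lie_algebra_axioms
  let ?Z' = "Z - {z0}"
  obtain f' where f': "lie_hom_on scale bracket free_scale free_bracket (lie_span ?Z') f'"
    "\<And>z. z \<in> ?Z' \<Longrightarrow> f' z = free_gen z"
    using lie_indep_extension[OF lie_indep_mono[OF Z(1)] FL, of ?Z' free_gen] by auto
  let ?g = "\<lambda>z. if z = z0 then free_scale (inverse c) (free_gen h - f' q) else free_gen z"
  obtain f where f: "lie_hom_on scale bracket free_scale free_bracket (lie_span Z) f"
    "\<And>z. z \<in> Z \<Longrightarrow> f z = ?g z"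
    using lie_indep_extension[OF Z(1) FL, of ?g] by auto
  have sub: "lie_span ?Z' \<subseteq> lie_span Z" by (rule hull_mono) auto
  have "f q = f' q"
    by (rule hom_on_agree[OF FL lie_hom_on_subset[OF f(1) sub] f'(1) _ q]) (auto simp: f f')
  moreover have "f h = free_scale c (f z0) + f q"
    using f(1) q sub Z(2) unfolding h lie_hom_on_def
    by (simp add: subsetD lie_span_base subspace_scale)
  ultimately have fh: "f h = free_gen h" using f(2)[OF Z(2)] c by simp
  show ?thesis
  proof (rule lie_indepI[OF lie_subalgebra_hull f(1)])
    show "insert h ?Z' \<subseteq> lie_span Z"
      using q sub Z(2) unfolding h
      by (auto intro!: subspace_add subspace_scale intro: lie_span_base)
    show "f z = free_gen z" if "z \<in> insert h ?Z'" for z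
      using that fh f(2) by auto
  qed
qed

end

section \<open>Lazard elimination\<close>

text \<open>
  A map \<open>p\<close> of the free generators extends to a derivation of the free Lie algebra. The extension is
  computed on formal expressions; \<open>derive_term_equiv\<close> says that it respects the axioms.
\<close>

primrec derive_term :: "('x \<Rightarrow> 'x) \<Rightarrow> ('f::field, 'x) lie_term \<Rightarrow> ('f, 'x) free_lie" where
  "derive_term p (Gen x) = free_gen (p x)"
| "derive_term p Zero = 0"
| "derive_term p (Add s t) = derive_term p s + derive_term p t"
| "derive_term p (Scale c t) = free_scale c (derive_term p t)"
| "derive_term p (Bracket s t) =
    free_bracket (derive_term p s) (abs_free_lie t) + free_bracket (abs_free_lie s) (derive_term p t)"

lemmas free_lie_abs_simps =
  zero_free_lie.abs_eq[symmetric] plus_free_lie.abs_eq[symmetric] free_scale.abs_eq[symmetric]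
  free_bracket.abs_eq[symmetric] free_gen.abs_eq[symmetric]

lemma derive_term_equiv: "lie_equiv s t \<Longrightarrow> derive_term p s = derive_term p t"
proof (induction rule: lie_equiv.induct)
  case (cong_Bracket s s' t t')
  then have "abs_free_lie s = abs_free_lie s'" "abs_free_lie t = abs_free_lie t'"
    by (simp_all add: free_lie.abs_eq_iff)
  with cong_Bracket show ?case by simp
next
  case (bracket_self t)
  show ?case
    using free_lie.bracket_anticommute[of "abs_free_lie t" "derive_term p t"] by simp
next
  case (jacobi s t u)
  let ?D = "derive_term p" and ?a = "abs_free_lie"
  have "?D (Add (Add (Bracket s (Bracket t u)) (Bracket t (Bracket u s))) (Bracket u (Bracket s t)))
    = (free_bracket (?D s) (free_bracket (?a t) (?a u)) + free_bracket (?a t) (free_bracket (?a u) (?D s))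
        + free_bracket (?a u) (free_bracket (?D s) (?a t)))
    + (free_bracket (?a s) (free_bracket (?D t) (?a u)) + free_bracket (?D t) (free_bracket (?a u) (?a s))
        + free_bracket (?a u) (free_bracket (?a s) (?D t)))
    + (free_bracket (?a s) (free_bracket (?a t) (?D u)) + free_bracket (?a t) (free_bracket (?D u) (?a s))
        + free_bracket (?D u) (free_bracket (?a s) (?a t)))"
    by (simp add: free_lie_abs_simps free_lie.bracket_add_right ac_simps)
  then show ?case by (simp only: free_lie.jacobi) simp
qed (simp_all add: ac_simps free_lie_abs_simps free_lie.scale_right_distrib
  free_lie.scale_left_distrib free_lie.bracket_add_left free_lie.bracket_add_right
  free_lie.bracket_scale_left free_lie.bracket_scale_right)

definition free_derive :: "('x \<Rightarrow> 'x) \<Rightarrow> ('f::field, 'x) free_lie \<Rightarrow> ('f, 'x) free_lie" where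
  "free_derive p a = derive_term p (rep_free_lie a)"

lemma free_derive_abs: "free_derive p (abs_free_lie t) = derive_term p t"
  unfolding free_derive_def
  by (rule derive_term_equiv) (metis Quotient_free_lie Quotient_rep_abs lie_equiv.refl)

lemma free_derive_simps:
  "free_derive p (free_gen x) = free_gen (p x)"
  "free_derive p (a + b) = free_derive p a + free_derive p b"
  "free_derive p (free_scale c a) = free_scale c (free_derive p a)"
  "free_derive p (free_bracket a b) =
    free_bracket (free_derive p a) b + free_bracket a (free_derive p b)"
proof -
  show "free_derive p (free_gen x) = free_gen (p x)"
    by (simp add: free_gen.abs_eq free_derive_abs)
  obtain s where s: "a = abs_free_lie s" by (induction a rule: free_lie.abs_induct) auto
  obtain t where t: "b = abs_free_lie t" by (induction b rule: free_lie.abs_induct) auto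
  note st = s t
  show "free_derive p (a + b) = free_derive p a + free_derive p b"
    by (simp add: st plus_free_lie.abs_eq free_derive_abs)
  show "free_derive p (free_scale c a) = free_scale c (free_derive p a)"
    by (simp add: st free_scale.abs_eq free_derive_abs)
  show "free_derive p (free_bracket a b) =
    free_bracket (free_derive p a) b + free_bracket a (free_derive p b)"
    by (simp add: st free_bracket.abs_eq free_derive_abs)
qed

context lie_algebra
begin

text \<open>
  The pair \<open>(a, c)\<close> stands for \<open>a + c \<delta>\<close>, where \<open>\<delta>\<close> is a new element with \<open>[\<delta>, a] = D a\<close>.
\<close>

lemma semidirect_lie_algebra:
  assumes D_add: "\<And>x y. D (x + y) = D x + D y"
    and D_scale: "\<And>c x. D (scale c x) = scale c (D x)"
    and D_bracket: "\<And>x y. D (bracket x y) = bracket (D x) y + bracket x (D y)"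
  shows "lie_algebra (\<lambda>k (a, c). (scale k a, k * c))
    (\<lambda>(a, c) (b, d). (bracket a b + scale c (D b) - scale d (D a), 0))"
proof (unfold_locales, goal_cases)
  case (10 x y z)
  obtain a i where x: "x = (a, i)" by (cases x)
  obtain b j where y: "y = (b, j)" by (cases y)
  obtain c k where z: "z = (c, k)" by (cases z)
  have D_diff: "D (x - y) = D x - D y" for x y
    using D_add[of "x - y" y] by (simp add: algebra_simps)
  have D_0: "D 0 = 0" using D_add[of 0 0] by simp
  have bd: "bracket x (y - z) = bracket x y - bracket x z" for x y z
    using bracket_add_right[of x "y - z" z] by (simp add: algebra_simps)
  have sk: "bracket (D a) b = - bracket b (D a)" "bracket (D b) c = - bracket c (D b)"
    "bracket (D c) a = - bracket a (D c)"
    by (rule bracket_anticommute)+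
  have j: "bracket a (bracket b c) = - bracket b (bracket c a) - bracket c (bracket a b)"
    using jacobi[of a b c] by (simp add: algebra_simps eq_neg_iff_add_eq_0)
  have sm: "scale i (scale j v) = scale (j * i) v" for i j v
    by (simp add: mult.commute)
  show ?case
    unfolding x y z prod.case plus_prod_def zero_prod_def fst_conv snd_conv prod.inject
      bd bracket_add_right bracket_scale_right bracket_scale_left D_add D_diff D_scale D_bracket sk j
    by (simp add: scale_right_distrib scale_right_diff_distrib mult.commute)
next
  case (9 x)
  show ?case by (cases x) (simp add: bracket_self zero_prod_def)
qed (auto simp: bracket_add_left bracket_add_right bracket_scale_left bracket_scale_right
    D_add D_scale scale_right_distrib scale_left_distrib mult.commute
    scale_right_diff_distrib zero_prod_def algebra_simps)

text \<open>
  Let \<open>l\<close> be extended to the Lie homomorphism from \<open>lie_span Z\<close> to the ground field (with zero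
  bracket) and let \<open>l z0 = 1\<close>. Subtracting \<open>scale (l z) z0\<close> moves every other generator into its
  kernel, and \<open>elimination l z0 Z\<close> consists of the iterated brackets of \<open>z0\<close> with the results: the
  generators that Lazard elimination produces for the kernel.
\<close>

definition elimination :: "('a \<Rightarrow> 'f) \<Rightarrow> 'a \<Rightarrow> 'a set \<Rightarrow> 'a set" where
  "elimination l z0 Z = {((bracket z0) ^^ k) (z - scale (l z) z0) | z k. z \<in> Z - {z0}}"

lemma elimination_bracket: "w \<in> elimination l z0 Z \<Longrightarrow> bracket z0 w \<in> elimination l z0 Z"
proof -
  assume "w \<in> elimination l z0 Z"
  then obtain z k where "z \<in> Z - {z0}" "w = ((bracket z0) ^^ k) (z - scale (l z) z0)"
    by (auto simp: elimination_def)
  then show ?thesis unfolding elimination_def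
    by (intro CollectI exI[of _ z] exI[of _ "Suc k"]) simp
qed

lemma elimination_induct [consumes 1, case_names base bracket]:
  assumes "w \<in> elimination l z0 Z"
    and "\<And>z. z \<in> Z \<Longrightarrow> z \<noteq> z0 \<Longrightarrow> Q (z - scale (l z) z0)"
    and "\<And>w. w \<in> elimination l z0 Z \<Longrightarrow> Q w \<Longrightarrow> Q (bracket z0 w)"
  shows "Q w"
proof -
  obtain z k where z: "z \<in> Z - {z0}" and w: "w = ((bracket z0) ^^ k) (z - scale (l z) z0)"
    using assms(1) by (auto simp: elimination_def)
  have "Q (((bracket z0) ^^ k) (z - scale (l z) z0))"
  proof (induction k)
    case (Suc k)
    have "((bracket z0) ^^ k) (z - scale (l z) z0) \<in> elimination l z0 Z"
      using z by (auto simp: elimination_def)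
    with Suc show ?case using assms(3) by simp
  qed (use z assms(2) in auto)
  then show ?thesis by (simp add: w)
qed

lemma elimination_subset:
  assumes "z0 \<in> Z" shows "elimination l z0 Z \<subseteq> lie_span Z"
proof
  fix w assume "w \<in> elimination l z0 Z"
  then show "w \<in> lie_span Z"
    by (induction rule: elimination_induct)
      (auto intro!: subspace_diff subspace_scale lie_span_bracket
        intro: lie_span_base assms)
qed

text \<open>
  The free Lie algebra with one generator for each element \<open>w\<close> of the given algebra has a
  derivation that moves the generator \<open>w\<close> to the generator \<open>bracket z0 w\<close>. In its semidirect product
  with the line spanned by that derivation, send \<open>z0\<close> to the derivation. Then bracketing
  with \<open>z0\<close> becomes the derivation, so every element of the elimination set, which is closed under
  \<open>bracket z0\<close>, is mapped to the free generator that carries its own name.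
\<close>

lemma lie_indep_elimination:
  assumes Z: "lie_indep Z" "z0 \<in> Z"
  shows "lie_indep (elimination l z0 Z)"
proof -
  let ?W = "elimination l z0 Z"
  let ?D = "free_derive (bracket z0) :: ('f, 'a) free_lie \<Rightarrow> ('f, 'a) free_lie"
  let ?s = "\<lambda>k (a, c). (free_scale k a, k * c)"
  let ?b = "\<lambda>(a, c) (b, d). (free_bracket a b + free_scale c (?D b) - free_scale d (?D a), 0)"
  \<comment> \<open>The second component is prescribed as \<open>l z\<close> so that it cancels in \<open>z - scale (l z) z0\<close>.\<close>
  let ?g = "\<lambda>z. if z = z0 then (0, 1) else (free_gen (z - scale (l z) z0), l z)"
  have SD: "lie_algebra ?s ?b"
    by (rule free_lie.semidirect_lie_algebra) (simp_all add: free_derive_simps)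
  then interpret S: lie_algebra ?s ?b .
  obtain h where h: "lie_hom_on scale bracket ?s ?b (lie_span Z) h" "\<And>z. z \<in> Z \<Longrightarrow> h z = ?g z"
    using lie_indep_extension[OF Z(1) SD, of ?g] by auto
  have z0: "z0 \<in> lie_span Z" "h z0 = (0, 1)"
    using Z(2) h(2) by (auto intro: lie_span_base)
  have D0: "?D 0 = 0"
    using free_derive_simps(2)[of "bracket z0" 0 0] by simp
  have hW: "h w = (free_gen w, 0)" if "w \<in> ?W" for w
    using that
  proof (induction w rule: elimination_induct)
    case (base z)
    then have z: "z \<in> lie_span Z" by (auto intro: lie_span_base)
    have "scale (- l z) z0 \<in> lie_span Z" by (intro subspace_scale z0) simp
    then have "h (z + scale (- l z) z0) = h z + ?s (- l z) (h z0)"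
      by (simp only: lie_hom_on_add[OF h(1) z] lie_hom_on_scale[OF h(1) z0(1)])
    then show ?case
      using base h(2)[of z] z0(2) by simp
  next
    case (bracket w)
    then have "w \<in> lie_span Z" using elimination_subset[OF Z(2)] by blast
    then have "h (bracket z0 w) = ?b (h z0) (h w)"
      by (rule lie_hom_on_bracket[OF h(1) z0(1)])
    then show ?case
      using bracket by (simp add: z0 free_derive_simps)
  qed
  have sub: "lie_span ?W \<subseteq> lie_span Z"
    by (rule lie_span_least[OF elimination_subset[OF Z(2)]])
  note hh = lie_hom_onD[OF lie_hom_on_subset[OF h(1) sub]]
  have h_snd: "snd (h a) = 0" if "a \<in> lie_span ?W" for a
    using that
  proof (induction a rule: lie_span_induct)
    case zero
    have "0 \<in> lie_span ?W" by (simp add: subspace_0)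
    from hh(1)[OF this this] show ?case by simp
  qed (auto simp: hh hW case_prod_unfold)
  have "lie_hom_on scale bracket free_scale free_bracket (lie_span ?W) (\<lambda>a. fst (h a))"
    unfolding lie_hom_on_def using h_snd by (auto simp: hh case_prod_unfold)
  then show ?thesis
    by (rule lie_indepI[OF lie_subalgebra_hull]) (auto simp: hW intro: lie_span_base)
qed

text \<open>
  The subalgebra generated by the elimination set has codimension at most one, because it is an
  ideal: it is stable under \<open>bracket z0\<close>, and the remaining generators lie in it up to multiples of
  \<open>z0\<close>.
\<close>

lemma lie_span_elimination:
  assumes "z0 \<in> Z" "a \<in> lie_span Z"
  shows "\<exists>c. a - scale c z0 \<in> lie_span (elimination l z0 Z)"
proof -
  let ?W = "lie_span (elimination l z0 Z)"
  have D: "bracket z0 w \<in> ?W" if "w \<in> ?W" for w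
    using that
  proof (induction w rule: lie_span_induct)
    case (base w)
    then show ?case by (intro lie_span_base elimination_bracket)
  next
    case (bracket x y)
    then show ?case unfolding bracket_derivation[of z0]
      by (intro subspace_add) (auto intro: lie_span_bracket)
  qed (simp_all add: subspace_0 bracket_add_right bracket_scale_right subspace_add subspace_scale)
  show ?thesis using assms(2)
  proof (induction a rule: lie_span_induct)
    case (base z)
    show ?case
    proof (cases "z = z0")
      case True
      then show ?thesis by (intro exI[of _ 1]) (simp add: subspace_0)
    next
      case False
      then have "z - scale (l z) z0 \<in> elimination l z0 Z"
        using base unfolding elimination_def by (intro CollectI exI[of _ z] exI[of _ 0]) simp
      then show ?thesis by (intro exI[of _ "l z"] lie_span_base)
    qed
  next
    case zero
    show ?case by (intro exI[of _ 0]) (simp add: subspace_0)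
  next
    case (add x y)
    then obtain c d where "x - scale c z0 \<in> ?W" "y - scale d z0 \<in> ?W" by blast
    then have "(x - scale c z0) + (y - scale d z0) \<in> ?W" by (rule subspace_add[rotated]) simp
    then show ?case by (intro exI[of _ "c + d"]) (simp add: scale_left_distrib algebra_simps)
  next
    case (scale k x)
    then obtain c where "x - scale c z0 \<in> ?W" by blast
    then have "scale k (x - scale c z0) \<in> ?W" by (rule subspace_scale[rotated]) simp
    then show ?case by (intro exI[of _ "k * c"]) (simp add: scale_right_diff_distrib)
  next
    case (bracket x y)
    then obtain c d where w: "x - scale c z0 \<in> ?W" "y - scale d z0 \<in> ?W" by blast
    define u v where "u = x - scale c z0" and "v = y - scale d z0"
    have xy: "x = u + scale c z0" "y = v + scale d z0" by (simp_all add: u_def v_def)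
    have "bracket x y = bracket u v + scale c (bracket z0 v) - scale d (bracket z0 u)"
      using bracket_anticommute[of z0 u]
      by (simp add: xy bracket_add_left bracket_add_right bracket_scale_left bracket_scale_right
          bracket_self scale_minus_right algebra_simps)
    also have "\<dots> \<in> ?W"
      using w unfolding u_def[symmetric] v_def[symmetric]
      by (intro subspace_add subspace_diff subspace_scale lie_span_bracket D) auto
    finally show ?case by (intro exI[of _ 0]) simp
  qed
qed

end

section \<open>Two facts of linear algebra\<close>

context vector_space
begin

lemma separating_functional:
  assumes S: "subspace S" and z: "z \<notin> S"
  obtains l where "\<And>x y. l (x + y) = l x + l y" and "\<And>c x. l (scale c x) = c * l x"
    and "\<And>x. x \<in> S \<Longrightarrow> l x = 0" and "l z = 1"
proof -
  obtain B where B: "B \<subseteq> S" "independent B" "S \<subseteq> span B"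
    using maximal_independent_subset by blast
  then have "span B = S" using S by (simp add: span_subspace)
  with z have "z \<notin> span B" by simp
  then have ind: "independent (insert z B)" using B(2) by (rule independent_insertI)
  obtain E where E: "insert z B \<subseteq> E" "independent E" "UNIV \<subseteq> span E"
    using maximal_independent_subset_extend[OF _ ind, of UNIV] by auto
  have in_span: "x \<in> span E" for x using E(3) by blast
  show ?thesis
  proof (rule that[of "\<lambda>x. representation E x z"])
    show "representation E (x + y) z = representation E x z + representation E y z" for x y
      by (simp add: representation_add[OF E(2) in_span in_span])
    show "representation E (scale c x) z = c * representation E x z" for c x
      by (simp add: representation_scale[OF E(2) in_span])
    show "representation E z z = 1"
      using E(1,2) by (simp add: representation_basis)
    show "representation E x z = 0" if "x \<in> S" for x
    proof -
      have "representation E x = representation B x"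
        using that B(3) E(1) by (intro representation_extend[OF E(2)]) auto
      moreover have "z \<notin> B" using \<open>z \<notin> span B\<close> span_base by blast
      ultimately show ?thesis using representation_ne_zero by fastforce
    qed
  qed
qed

lemma dim_strict_subset:
  assumes "subspace S" "S \<subseteq> T" "z \<in> T" "z \<notin> S" "finite F" "T \<subseteq> span F"
  shows "dim S < dim T"
proof -
  obtain B where B: "B \<subseteq> S" "independent B" "S \<subseteq> span B" "card B = dim S"
    using basis_exists by blast
  obtain C where C: "C \<subseteq> T" "independent C" "T \<subseteq> span C" "card C = dim T"
    using basis_exists by blast
  have finC: "finite C" using independent_span_bound[OF assms(5) C(2)] C(1) assms(6) by blast
  have zB: "z \<notin> span B" using assms(1,4) B(1) span_minimal by blast
  then have ind: "independent (insert z B)" using B(2) by (rule independent_insertI)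
  have *: "finite (insert z B) \<and> card (insert z B) \<le> card C"
    using B(1) C(3) assms(2,3) by (intro independent_span_bound[OF finC ind]) auto
  have "z \<notin> B" using zB span_base by blast
  then have "card (insert z B) = Suc (card B)" using * by simp
  then show ?thesis using * B(4) C(4) by simp
qed

end

section \<open>Homogeneous subsets of a graded free Lie algebra\<close>

text \<open>
  A grading by positive degrees with finite-dimensional pieces, encoded by the projections
  \<open>component d\<close> onto the pieces.
\<close>

locale graded_lie_algebra = lie_algebra scale bracket
  for scale :: "'f::field \<Rightarrow> 'a::ab_group_add \<Rightarrow> 'a" and bracket +
  fixes component :: "nat \<Rightarrow> 'a \<Rightarrow> 'a"
  assumes component_add: "component d (x + y) = component d x + component d y"
    and component_scale: "component d (scale c x) = scale c (component d x)"
    and component_bracket: "component d (bracket x y) = (\<Sum>i\<le>d. bracket (component i x) (component (d - i) y))"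
    and component_component: "component d (component e x) = (if d = e then component d x else 0)"
    and component_0: "component 0 x = 0"
    and component_sum: "\<exists>N. x = (\<Sum>d\<le>N. component d x)"
    and component_finite: "\<exists>F. finite F \<and> range (component d) \<subseteq> span F"
begin

lemma component_zero [simp]: "component d 0 = 0"
  using component_add[of d 0 0] by simp

lemma component_diff: "component d (x - y) = component d x - component d y"
  using component_add[of d "x - y" y] by (simp add: algebra_simps)

lemma component_of_sum: "component d (\<Sum>i\<in>I. f i) = (\<Sum>i\<in>I. component d (f i))"
  by (induction I rule: infinite_finite_induct) (simp_all add: component_add)

lemma component_other_degree: "component d x = x \<Longrightarrow> e \<noteq> d \<Longrightarrow> component e x = 0"
  using component_component[of e d x] by simp

definition homogeneous :: "'a set \<Rightarrow> bool" where
  "homogeneous Z \<longleftrightarrow> (\<forall>z\<in>Z. \<exists>d. component d z = z)"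

lemma homogeneous_component:
  "homogeneous Z \<Longrightarrow> z \<in> Z \<Longrightarrow> component e z = z \<or> component e z = 0"
  unfolding homogeneous_def by (metis component_component)

lemma lie_span_component:
  assumes Z: "homogeneous Z" and a: "a \<in> lie_span Z"
  shows "component d a \<in> lie_span Z"
  using a
proof (induction a arbitrary: d rule: lie_span_induct)
  case (base x)
  then show ?case
    using homogeneous_component[OF Z base, of d] by (auto simp: subspace_0 intro: lie_span_base)
qed (simp_all add: component_add component_scale component_bracket subspace_0 subspace_add subspace_scale
    lie_span_bracket subspace_sum)

text \<open>
  Degrees are positive, so brackets contribute to degree \<open>d\<close> only through factors of smaller degree.
  Hence, modulo the generators of smaller degree, the piece of degree \<open>d\<close> is spanned by the generators
  of degree \<open>d\<close>.
\<close>

lemma component_lie_span_decomposition: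
  assumes Z: "homogeneous Z" and a: "a \<in> lie_span Z"
  shows "\<exists>u\<in>span {z\<in>Z. component d z = z}. component d a - u \<in> lie_span {z\<in>Z. \<exists>e<d. component e z = z}"
  (is "\<exists>u\<in>span (?E d). _ \<in> lie_span (?L d)")
  using a
proof (induction a arbitrary: d rule: lie_span_induct)
  case (base x)
  show ?case
  proof (cases "component d x = x")
    case True
    then show ?thesis using base by (intro bexI[of _ x]) (auto simp: subspace_0 span_base)
  next
    case False
    then have "component d x = 0" using homogeneous_component[OF Z base] by blast
    then show ?thesis by (intro bexI[of _ 0]) (auto simp: subspace_0 span_zero)
  qed
next
  case zero
  show ?case by (intro bexI[of _ 0]) (auto simp: subspace_0 span_zero)
next
  case (add x y)
  obtain u v where u: "u \<in> span (?E d)" "component d x - u \<in> lie_span (?L d)"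
    and v: "v \<in> span (?E d)" "component d y - v \<in> lie_span (?L d)"
    using add.IH by meson
  have "(component d x - u) + (component d y - v) \<in> lie_span (?L d)"
    using u v by (simp add: subspace_add)
  then show ?case
    by (intro bexI[of _ "u + v"] span_add u v) (simp add: component_add algebra_simps)
next
  case (scale c x)
  obtain u where u: "u \<in> span (?E d)" "component d x - u \<in> lie_span (?L d)"
    using scale.IH by meson
  have "scale c (component d x - u) \<in> lie_span (?L d)"
    using u by (simp add: subspace_scale)
  then show ?case
    by (intro bexI[of _ "scale c u"] span_scale u) (simp add: component_scale scale_right_diff_distrib)
next
  case (bracket x y)
  have low: "component i w \<in> lie_span (?L d)"
    if "i < d" "\<exists>u\<in>span (?E i). component i w - u \<in> lie_span (?L i)" for i w
  proof -
    from that(2) obtain u where u: "u \<in> span (?E i)" "component i w - u \<in> lie_span (?L i)"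
      by blast
    have "?E i \<subseteq> lie_span (?L d)" using that(1) by (auto intro!: lie_span_base)
    then have "u \<in> lie_span (?L d)" using u(1) span_subset_lie_span by blast
    moreover have "lie_span (?L i) \<subseteq> lie_span (?L d)"
      using that(1) by (intro hull_mono) (auto intro: less_trans)
    ultimately have "(component i w - u) + u \<in> lie_span (?L d)"
      using u(2) by (intro subspace_add) auto
    then show ?thesis by simp
  qed
  have "bracket (component i x) (component (d - i) y) \<in> lie_span (?L d)" if "i \<le> d" for i
  proof (cases "i = 0 \<or> i = d")
    case True
    then show ?thesis by (auto simp: component_0 subspace_0)
  next
    case False
    then have "i < d" "d - i < d" using that by auto
    then show ?thesis using low bracket.IH by (intro lie_span_bracket) blast+
  qed
  then have "component d (bracket x y) \<in> lie_span (?L d)"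
    unfolding component_bracket by (intro subspace_sum) auto
  then show ?case by (intro bexI[of _ 0]) (auto simp: span_zero)
qed

definition filtration :: "nat \<Rightarrow> 'a set" where
  "filtration n = {x. \<forall>d>n. component d x = 0}"

lemma subspace_filtration [simp]: "subspace (filtration n)"
  by (rule subspaceI) (auto simp: filtration_def component_add component_scale)

lemma component_eventually_zero: "\<exists>N. x \<in> filtration N"
proof -
  obtain N where N: "x = (\<Sum>d\<le>N. component d x)" using component_sum by blast
  have "component e x = 0" if "e > N" for e
    using that by (subst N) (simp add: component_of_sum component_component)
  then show ?thesis by (auto simp: filtration_def)
qed

lemma sum_component:
  assumes "x \<in> filtration n" shows "x = (\<Sum>d\<le>n. component d x)"
proof -
  obtain N where N: "x = (\<Sum>d\<le>N. component d x)" using component_sum by blast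
  have *: "component e x = 0" if "e > N" for e
    using that by (subst N) (simp add: component_of_sum component_component)
  have "(\<Sum>d\<le>N. component d x) = (\<Sum>d\<le>max N n. component d x)"
    by (rule sum.mono_neutral_left) (auto simp: * not_le)
  also have "\<dots> = (\<Sum>d\<le>n. component d x)"
    using assms by (intro sum.mono_neutral_right) (auto simp: filtration_def not_le)
  finally show ?thesis using N by simp
qed

lemma filtration_finite: "\<exists>F. finite F \<and> filtration n \<subseteq> span F"
proof -
  obtain F where F: "\<And>d. finite (F d) \<and> range (component d) \<subseteq> span (F d)"
    using component_finite by metis
  have "filtration n \<subseteq> span (\<Union>d\<le>n. F d)"
  proof
    fix x assume "x \<in> filtration n"
    then have "x = (\<Sum>d\<le>n. component d x)" by (rule sum_component)
    also have "\<dots> \<in> span (\<Union>d\<le>n. F d)"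
    proof (rule span_sum)
      fix d assume "d \<in> {..n}"
      then have "span (F d) \<subseteq> span (\<Union>d\<le>n. F d)" by (intro span_mono) auto
      then show "component d x \<in> span (\<Union>d\<le>n. F d)" using F[of d] by auto
    qed
    finally show "x \<in> span (\<Union>d\<le>n. F d)" .
  qed
  then show ?thesis using F by (intro exI[of _ "\<Union>d\<le>n. F d"]) auto
qed

text \<open>
  If \<open>l\<close> is supported in the degree of \<open>z0\<close>, the generators that are corrected by multiples of
  \<open>z0\<close> have the same degree as \<open>z0\<close>.
\<close>

lemma homogeneous_elimination:
  assumes Z: "homogeneous Z" and z0: "component d z0 = z0"
    and l: "\<And>z. component d z = 0 \<Longrightarrow> l z = 0"
  shows "homogeneous (elimination l z0 Z)"
  unfolding homogeneous_def
proof
  fix w assume "w \<in> elimination l z0 Z"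
  then show "\<exists>e. component e w = w"
  proof (induction w rule: elimination_induct)
    case (base z)
    then consider "component d z = z" | "component d z = 0" using homogeneous_component[OF Z] by blast
    then show ?case
    proof cases
      case 1
      then show ?thesis by (intro exI[of _ d]) (simp add: component_diff component_scale z0)
    next
      case 2
      then show ?thesis using l[OF 2] Z base unfolding homogeneous_def by simp
    qed
  next
    case (bracket w)
    then obtain e where e: "component e w = w" by blast
    have "component (d + e) (bracket z0 w)
        = (\<Sum>i\<le>d + e. if i = d then bracket z0 w else 0)"
      unfolding component_bracket
    proof (rule sum.cong[OF HOL.refl])
      fix i assume "i \<in> {..d + e}"
      show "bracket (component i z0) (component (d + e - i) w) = (if i = d then bracket z0 w else 0)"
        using z0 e component_other_degree[OF z0, of i] by auto
    qed
    then show ?case by (intro exI[of _ "d + e"]) simp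
  qed
qed

text \<open>
  A graded subalgebra \<open>lie_span H\<close> of a free Lie algebra agrees, up to a given degree \<open>n\<close>, with a free subalgebra on
  homogeneous generators. Among the free subalgebras \<open>lie_span Z\<close> containing \<open>H\<close>, take one whose part
  of degree at most \<open>n\<close> has minimal dimension. If it were larger than that of \<open>lie_span H\<close>, then in the
  first degree \<open>d\<close> where they differ some generator \<open>z0\<close> would lie outside \<open>lie_span H\<close>. A functional
  that separates \<open>z0\<close> from \<open>lie_span H\<close> vanishes on brackets, since in degree \<open>d\<close> these are formed from
  elements of smaller degree and so belong to \<open>lie_span H\<close>. Eliminating \<open>z0\<close> along this functional
  gives a free subalgebra that still contains \<open>H\<close> but no longer \<open>z0\<close>.
\<close>

lemma lie_indep_reduction:
  assumes Z0: "lie_indep Z0" "homogeneous Z0" "H \<subseteq> lie_span Z0" and H: "homogeneous H"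
  obtains Z where "lie_indep Z" "homogeneous Z" "H \<subseteq> lie_span Z"
    and "\<And>d a. d \<le> n \<Longrightarrow> a \<in> lie_span Z \<Longrightarrow> component d a \<in> lie_span H"
proof -
  let ?good = "\<lambda>Z. lie_indep Z \<and> homogeneous Z \<and> H \<subseteq> lie_span Z"
  define m where "m Z = dim (lie_span Z \<inter> filtration n)" for Z
  obtain Z where Z: "?good Z" and min: "\<And>Z'. ?good Z' \<Longrightarrow> m Z \<le> m Z'"
    using arg_min_nat_lemma[of ?good Z0 m] Z0 by blast
  have HZ: "lie_span H \<subseteq> lie_span Z" using Z lie_span_least by blast
  have "component d a \<in> lie_span H" if "d \<le> n" "a \<in> lie_span Z" for d a
    using that
  proof (induction d arbitrary: a rule: less_induct)
    case (less d)
    show ?case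
    proof (rule ccontr)
      assume a: "component d a \<notin> lie_span H"
      have low: "component e x \<in> lie_span H" if "e < d" "x \<in> lie_span Z" for e x
        using less.IH[OF that(1) _ that(2)] that(1) less.prems(1) by simp
      have "{z\<in>Z. \<exists>e<d. component e z = z} \<subseteq> lie_span H"
        using low lie_span_base by fastforce
      then have q: "lie_span {z\<in>Z. \<exists>e<d. component e z = z} \<subseteq> lie_span H" by (rule lie_span_least)
      obtain u where u: "u \<in> span {z\<in>Z. component d z = z}"
        "component d a - u \<in> lie_span {z\<in>Z. \<exists>e<d. component e z = z}"
        using component_lie_span_decomposition[of Z a d] Z less.prems(2) by blast
      have "u \<notin> lie_span H"
      proof
        assume "u \<in> lie_span H"
        then have "(component d a - u) + u \<in> lie_span H"
          using u(2) q by (intro subspace_add) auto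
        then show False using a by simp
      qed
      then obtain z0 where z0: "z0 \<in> Z" "component d z0 = z0" "z0 \<notin> lie_span H"
        using u(1) span_subset_lie_span[of "{z\<in>Z. component d z = z}" H] by blast
      obtain l0 where l0_add: "\<And>x y. l0 (x + y) = l0 x + l0 y"
        and l0_scale: "\<And>c x. l0 (scale c x) = c * l0 x"
        and l0_H: "\<And>x. x \<in> lie_span H \<Longrightarrow> l0 x = 0" and l0_z0: "l0 z0 = 1"
        using separating_functional[OF lie_span_subspace z0(3)] by blast
      have l0_0: "l0 0 = 0" using l0_scale[of 0 0] by simp
      define l where "l x = l0 (component d x)" for x
      have l_add: "l (x + y) = l x + l y" for x y by (simp add: l_def component_add l0_add)
      have l_scale: "l (scale c x) = c * l x" for c x by (simp add: l_def component_scale l0_scale)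
      have l_z0: "l z0 = 1" by (simp add: l_def z0 l0_z0)
      have l_H: "l x = 0" if "x \<in> lie_span H" for x
        unfolding l_def using that H by (intro l0_H lie_span_component)
      have l_bracket: "l (bracket x y) = 0" if "x \<in> lie_span Z" "y \<in> lie_span Z" for x y
        unfolding l_def component_bracket
      proof (intro l0_H subspace_sum lie_span_subspace)
        fix i assume "i \<in> {..d}"
        then consider "i = 0" | "i = d" | "i < d" "d - i < d" by fastforce
        then show "bracket (component i x) (component (d - i) y) \<in> lie_span H"
          using that low by cases (auto simp: component_0 subspace_0 intro: lie_span_bracket)
      qed
      let ?W = "elimination l z0 Z"
      have WZ: "lie_span ?W \<subseteq> lie_span Z"
        by (rule lie_span_least[OF elimination_subset[OF z0(1)]])
      have l_W: "l x = 0" if "x \<in> lie_span ?W" for x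
        using that
      proof (induction x rule: lie_span_induct)
        case (base w)
        then show ?case
        proof (induction w rule: elimination_induct)
          case (base z)
          show ?case using l_add[of "z - scale (l z) z0" "scale (l z) z0"]
            by (simp add: l_scale l_z0)
        next
          case (bracket w)
          then show ?case
            using l_bracket lie_span_base z0(1) elimination_subset[OF z0(1)] by blast
        qed
      next
        case (bracket x y)
        then show ?case using l_bracket WZ by blast
      next
        case zero
        show ?case by (simp add: l_def l0_0)
      qed (simp_all add: l_add l_scale)
      have "H \<subseteq> lie_span ?W"
      proof
        fix h assume h: "h \<in> H"
        then obtain c where c: "h - scale c z0 \<in> lie_span ?W"
          using lie_span_elimination[OF z0(1)] Z by blast
        have "l h = l (h - scale c z0) + l (scale c z0)"
          using l_add[of "h - scale c z0" "scale c z0"] by simp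
        then have "c = 0"
          using l_W[OF c] l_H[OF lie_span_base[OF h]] by (simp add: l_scale l_z0)
        then show "h \<in> lie_span ?W" using c by simp
      qed
      moreover have "homogeneous ?W"
        using Z z0(2) by (intro homogeneous_elimination[where d = d]) (auto simp: l_def l0_0)
      ultimately have "m Z \<le> m ?W"
        using Z z0(1) by (intro min) (simp add: lie_indep_elimination)
      moreover have "m ?W < m Z"
      proof -
        have "z0 \<notin> lie_span ?W" using l_W l_z0 by force
        moreover have "z0 \<in> filtration n"
          using component_other_degree[OF z0(2)] less.prems(1) by (auto simp: filtration_def)
        moreover obtain F where "finite F" "filtration n \<subseteq> span F"
          using filtration_finite by blast
        ultimately show ?thesis
          unfolding m_def using WZ lie_span_base[OF z0(1)]
          by (intro dim_strict_subset[of _ _ z0 F]) (auto simp: subspace_inter)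
      qed
      ultimately show False by simp
    qed
  qed
  with Z that show ?thesis by blast
qed

text \<open>
  The Shirshov-Witt theorem in homogeneous form: redundancy is the only source of relations
  among homogeneous elements. With \<open>n\<close> at least all degrees in \<open>H\<close>, replace the ambient
  algebra by a free one that agrees with \<open>lie_span H\<close> up to degree \<open>n\<close>, and exchange the elements of
  \<open>H\<close> into its free generating set one after the other. A step can only fail if the element
  to be exchanged is expressed by those already exchanged and by elements of smaller degree; the
  latter are generated by the rest of \<open>H\<close>, so the element would be redundant.
\<close>

theorem lie_indep_homogeneous:
  assumes Z0: "lie_indep Z0" "homogeneous Z0" "H \<subseteq> lie_span Z0"
    and H: "finite H" "homogeneous H" "\<And>h. h \<in> H \<Longrightarrow> h \<notin> lie_span (H - {h})"
  shows "lie_indep H"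
proof -
  obtain deg where deg: "\<And>h. h \<in> H \<Longrightarrow> component (deg h) h = h"
    using H(2) unfolding homogeneous_def by metis
  obtain n where n: "\<And>h. h \<in> H \<Longrightarrow> deg h \<le> n"
    using H(1) by (meson Max_ge finite_imageI imageI)
  obtain Z1 where Z1: "lie_indep Z1" "homogeneous Z1" "H \<subseteq> lie_span Z1"
    "\<And>d a. d \<le> n \<Longrightarrow> a \<in> lie_span Z1 \<Longrightarrow> component d a \<in> lie_span H"
    using lie_indep_reduction[OF Z0 H(2)] by metis
  have "\<exists>Z. lie_indep Z \<and> homogeneous Z \<and> S \<subseteq> Z \<and> lie_span Z = lie_span Z1"
    if "finite S" "S \<subseteq> H" for S
    using that
  proof (induction S rule: finite_induct)
    case empty
    then show ?case using Z1 by blast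
  next
    case (insert h S)
    then obtain Z where Z: "lie_indep Z" "homogeneous Z" "S \<subseteq> Z" "lie_span Z = lie_span Z1"
      by blast
    have h: "h \<in> H" "component (deg h) h = h" "deg h \<le> n" using insert.prems deg n by auto
    let ?d = "deg h"
    let ?E = "{z\<in>Z. component ?d z = z}" and ?L = "{z\<in>Z. \<exists>e<?d. component e z = z}"
    have "h \<in> lie_span Z" using h(1) Z(4) Z1(3) by blast
    then obtain u where u: "u \<in> span ?E" "h - u \<in> lie_span ?L"
      using component_lie_span_decomposition[OF Z(2), of h ?d] h(2) by auto
    have h0: "h \<noteq> 0" using H(3)[OF h(1)] subspace_0[OF lie_span_subspace] by metis
    have L: "?L \<subseteq> lie_span (H - {h})"
    proof
      fix z assume "z \<in> ?L"
      then obtain e where e: "z \<in> Z" "e < ?d" "component e z = z" by blast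
      then have "component e z \<in> lie_span H"
        using h(3) Z(4) lie_span_base by (intro Z1(4)) auto
      then have zH: "z \<in> lie_span H" using e(3) by simp
      have ne: "component e' h \<noteq> h" if "e' \<le> e" for e'
        using that e(2) h0 component_other_degree[OF h(2), of e'] by auto
      obtain v where v: "v \<in> span {x\<in>H. component e x = x}"
        "z - v \<in> lie_span {x\<in>H. \<exists>e'<e. component e' x = x}"
        using component_lie_span_decomposition[OF H(2) zH, of e] e(3) by auto
      have "{x\<in>H. component e x = x} \<subseteq> lie_span (H - {h})"
        using ne[of e] by (auto intro!: lie_span_base)
      then have "v \<in> lie_span (H - {h})" using v(1) span_subset_lie_span by blast
      moreover have "lie_span {x\<in>H. \<exists>e'<e. component e' x = x} \<subseteq> lie_span (H - {h})"
        using ne by (intro hull_mono) (auto dest: less_imp_le)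
      ultimately have "(z - v) + v \<in> lie_span (H - {h})"
        using v(2) by (intro subspace_add) auto
      then show "z \<in> lie_span (H - {h})" by simp
    qed
    obtain F r where F: "finite F" "F \<subseteq> ?E" "u = (\<Sum>z\<in>F. scale (r z) z)"
      using u(1) unfolding span_explicit by blast
    \<comment> \<open>Asking for a nonzero summand gives \<open>r z0 \<noteq> 0\<close> and also \<open>z0 \<noteq> 0\<close>, so \<open>z0\<close> has only one degree.\<close>
    have "\<exists>z0\<in>F. z0 \<notin> S \<and> scale (r z0) z0 \<noteq> 0"
    proof (rule ccontr)
      assume "\<not> ?thesis"
      then have F': "z \<in> S" if "z \<in> F" "scale (r z) z \<noteq> 0" for z using that by blast
      have "scale (r z) z \<in> lie_span (H - {h})" if "z \<in> F" for z
      proof (cases "scale (r z) z = 0")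
        case False
        then have "z \<in> H - {h}" using F'[OF that] insert.hyps insert.prems by blast
        then show ?thesis by (intro subspace_scale lie_span_base) auto
      next
        case True
        show ?thesis unfolding True by (simp add: subspace_0)
      qed
      then have "u \<in> lie_span (H - {h})" unfolding F(3) by (intro subspace_sum) auto
      moreover have "h - u \<in> lie_span (H - {h})" using u(2) lie_span_least[OF L] by blast
      ultimately have "(h - u) + u \<in> lie_span (H - {h})" by (intro subspace_add) auto
      then show False using H(3)[OF h(1)] by simp
    qed
    then obtain z0 where z0: "z0 \<in> F" "z0 \<notin> S" "r z0 \<noteq> 0" "z0 \<noteq> 0" by auto
    have z0Z: "z0 \<in> Z" "component ?d z0 = z0" using z0(1) F(2) by auto
    define q where "q = h - scale (r z0) z0"
    have "z0 \<notin> ?L"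
      using component_other_degree[OF z0Z(2)] z0(4) by fastforce
    then have LZ: "?L \<subseteq> Z - {z0}" by blast
    have "q = (h - u) + (\<Sum>z\<in>F - {z0}. scale (r z) z)"
      using F(1) z0(1) by (simp add: q_def F(3) sum.remove)
    also have "\<dots> \<in> lie_span (Z - {z0})"
    proof (rule subspace_add[OF lie_span_subspace])
      show "(\<Sum>z\<in>F - {z0}. scale (r z) z) \<in> lie_span (Z - {z0})"
        using F(2) by (intro subspace_sum subspace_scale lie_span_subspace lie_span_base) auto
      show "h - u \<in> lie_span (Z - {z0})"
        using u(2) hull_mono[OF LZ, of lie_subalgebra] by blast
    qed
    finally have q: "q \<in> lie_span (Z - {z0})" .
    have hq: "h = scale (r z0) z0 + q" by (simp add: q_def)
    let ?Z = "insert h (Z - {z0})"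
    have "lie_indep ?Z" by (rule lie_indep_exchange[OF Z(1) z0Z(1) z0(3) q hq])
    moreover have "lie_span ?Z = lie_span Z1"
      using lie_span_exchange[OF z0Z(1) z0(3) q hq] Z(4) by simp
    moreover have "homogeneous ?Z"
      using Z(2) h(2) unfolding homogeneous_def by blast
    moreover have "insert h S \<subseteq> ?Z" using Z(3) z0(2) by blast
    ultimately show ?case by blast
  qed
  from this[OF H(1) order.refl] show ?thesis using lie_indep_mono by blast
qed

end

section \<open>Degree filtrations and leading components\<close>

context lie_algebra
begin

lemma subspace_degree_filtration [simp]: "subspace (degree_filtration X n)"
  by (simp add: degree_filtration_def)

lemma degree_filtration_mono: "m \<le> n \<Longrightarrow> degree_filtration X m \<subseteq> degree_filtration X n"
  unfolding degree_filtration_def by (rule span_mono) (auto intro: le_trans)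

lemma lie_monomial_in_degree_filtration:
  "lie_monomial X k a \<Longrightarrow> k \<le> n \<Longrightarrow> a \<in> degree_filtration X n"
  unfolding degree_filtration_def by (rule span_base) blast

lemma degree_filtration_base: "x \<in> X \<Longrightarrow> x \<in> degree_filtration X 1"
  by (rule lie_monomial_in_degree_filtration[OF lie_monomial.gen]) auto

lemma degree_filtration_bracket:
  assumes a: "a \<in> degree_filtration X m" and b: "b \<in> degree_filtration X n"
  shows "bracket a b \<in> degree_filtration X (m + n)"
proof -
  have 1: "bracket u b \<in> degree_filtration X (m + n)" if u: "lie_monomial X k u" "k \<le> m" for u k
    using b unfolding degree_filtration_def[of X n]
  proof (induction b rule: span_induct_alt)
    case base
    show ?case by (simp add: subspace_0)
  next
    case (step c v w)
    then obtain j where j: "j \<le> n" "lie_monomial X j v" by blast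
    have "bracket u v \<in> degree_filtration X (m + n)"
      using u j by (intro lie_monomial_in_degree_filtration[OF lie_monomial.comm]) auto
    with step show ?case
      by (simp add: bracket_add_right bracket_scale_right subspace_add subspace_scale)
  qed
  show ?thesis
    using a unfolding degree_filtration_def[of X m]
  proof (induction a rule: span_induct_alt)
    case base
    show ?case by (simp add: subspace_0)
  next
    case (step c v w)
    then show ?case using 1
      by (auto simp: bracket_add_left bracket_scale_left intro!: subspace_add subspace_scale)
  qed
qed

lemma lie_span_degree_filtration:
  assumes "a \<in> lie_span X" shows "\<exists>n. a \<in> degree_filtration X n"
  using assms
proof (induction a rule: lie_span_induct)
  case (base x)
  then show ?case using degree_filtration_base by blast
next
  case zero
  show ?case by (auto simp: subspace_0)
next
  case (add x y)
  then obtain m n where "x \<in> degree_filtration X m" "y \<in> degree_filtration X n" by blast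
  then have "x \<in> degree_filtration X (max m n)" "y \<in> degree_filtration X (max m n)"
    using degree_filtration_mono[of _ "max m n" X] by (meson max.cobounded1 max.cobounded2 subsetD)+
  then show ?case by (blast intro: subspace_add[OF subspace_degree_filtration])
next
  case (scale c x)
  then show ?case by (blast intro: subspace_scale[OF subspace_degree_filtration])
next
  case (bracket x y)
  then show ?case using degree_filtration_bracket by blast
qed

lemma lie_monomial_in_lie_span: "lie_monomial X k a \<Longrightarrow> a \<in> lie_span X"
  by (induction rule: lie_monomial.induct) (auto intro: lie_span_base lie_span_bracket)

lemma degree_filtration_subset_lie_span: "degree_filtration X n \<subseteq> lie_span X"
  unfolding degree_filtration_def
  by (rule span_subset_lie_span) (auto intro: lie_monomial_in_lie_span)

text \<open>
  The filtrations of different finite generating sets are comparable: a bound \<open>c\<close> for the degrees of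
  the elements of \<open>Y\<close> over \<open>X\<close> multiplies lengths by at most \<open>c\<close>.
\<close>

lemma degree_filtration_compare:
  assumes "finite Y" "Y \<subseteq> lie_span X"
  obtains c where "\<And>n. degree_filtration Y n \<subseteq> degree_filtration X (c * n)"
proof -
  have "\<forall>y\<in>Y. \<exists>n. y \<in> degree_filtration X n"
    using lie_span_degree_filtration assms(2) by blast
  from bchoice[OF this] obtain d where d: "\<And>y. y \<in> Y \<Longrightarrow> y \<in> degree_filtration X (d y)"
    by blast
  obtain c where c: "\<And>y. y \<in> Y \<Longrightarrow> d y \<le> c"
    using assms(1) by (meson Max_ge finite_imageI imageI)
  have mon: "a \<in> degree_filtration X (c * k)" if "lie_monomial Y k a" for k a
    using that
  proof (induction rule: lie_monomial.induct)
    case (gen y)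
    then show ?case using d[OF gen] degree_filtration_mono[OF c[OF gen], of X] by auto
  next
    case (comm m a n b)
    then show ?case using degree_filtration_bracket by (simp add: distrib_left)
  qed
  show ?thesis
  proof (rule that)
    fix n
    show "degree_filtration Y n \<subseteq> degree_filtration X (c * n)"
      unfolding degree_filtration_def[of Y]
    proof (rule span_minimal)
      show "{a. \<exists>k\<le>n. lie_monomial Y k a} \<subseteq> degree_filtration X (c * n)"
      proof clarify
        fix a k assume "k \<le> n" "lie_monomial Y k a"
        then show "a \<in> degree_filtration X (c * n)"
          using mon[of k a] degree_filtration_mono[of "c * k" "c * n" X] by auto
      qed
    qed simp
  qed
qed

text \<open>
  One expression \<open>S\<close> serves all assignments \<open>f\<close>, so that the two values of an expression that
  are compared below can be summed simultaneously.
\<close>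

lemma eval_term_sum:
  "\<exists>S. gens S \<subseteq> (\<Union>i\<le>N::nat. gens (s i)) \<and>
    (\<forall>f. eval_term f S = (\<Sum>i\<le>N. eval_term f (s i)))"
proof (induction N)
  case 0
  show ?case by (intro exI[of _ "s 0"]) simp
next
  case (Suc N)
  then obtain S where S: "gens S \<subseteq> (\<Union>i\<le>N. gens (s i))"
    "\<forall>f. eval_term f S = (\<Sum>i\<le>N. eval_term f (s i))" by blast
  show ?case
    using S by (intro exI[of _ "Add S (s (Suc N))"]) (auto simp: atMost_Suc)
qed

end

context graded_lie_algebra
begin

lemma component_bracket_filtration:
  assumes x: "x \<in> filtration i" and y: "y \<in> filtration j"
  shows filtration_bracket: "bracket x y \<in> filtration (i + j)"
    and component_bracket_top: "component (i + j) (bracket x y) = bracket (component i x) (component j y)"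
proof -
  have *: "bracket (component k x) (component (e - k) y) = 0" if "k > i \<or> e - k > j" for k e
    using that x y by (auto simp: filtration_def)
  have "component e (bracket x y) = 0" if "e > i + j" for e
    unfolding component_bracket using that by (intro sum.neutral ballI *) auto
  then show "bracket x y \<in> filtration (i + j)" by (simp add: filtration_def)
  have "component (i + j) (bracket x y) = (\<Sum>k\<in>{i}. bracket (component k x) (component (i + j - k) y))"
    unfolding component_bracket by (intro sum.mono_neutral_right ballI *) auto
  then show "component (i + j) (bracket x y) = bracket (component i x) (component j y)" by simp
qed

text \<open>
  The degree of \<open>0\<close> is \<open>0\<close>; nonzero elements have positive degree because \<open>component 0\<close> vanishes.
\<close>

definition degree :: "'a \<Rightarrow> nat" where
  "degree x = (LEAST n. x \<in> filtration n)"

definition leading :: "'a \<Rightarrow> 'a" where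
  "leading x = component (degree x) x"

lemma in_filtration_degree: "x \<in> filtration (degree x)"
  unfolding degree_def using component_eventually_zero by (rule LeastI_ex)

lemma degree_le: "x \<in> filtration n \<Longrightarrow> degree x \<le> n"
  unfolding degree_def by (rule Least_le)

lemma component_leading: "component d (leading x) = (if d = degree x then leading x else 0)"
  by (simp add: leading_def component_component)

lemma leading_nonzero:
  assumes "x \<noteq> 0" shows "leading x \<noteq> 0"
proof
  assume 0: "leading x = 0"
  have x: "x \<in> filtration (degree x)" by (rule in_filtration_degree)
  show False
  proof (cases "degree x")
    case 0
    then have "x = 0" using sum_component[OF x] by (simp add: component_0)
    with assms show False by simp
  next
    case (Suc k)
    have "component d x = 0" if "d > k" for d
      using that x 0 Suc by (cases "d = degree x") (auto simp: filtration_def leading_def)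
    then have "degree x \<le> k" by (intro degree_le) (simp add: filtration_def)
    then show False using Suc by simp
  qed
qed

text \<open>
  An expression \<open>t\<close> has two values, one in the leading components of \<open>Y\<close> and one in the elements of
  \<open>Y\<close> themselves. Here \<open>s\<close> is the part of weight \<open>d\<close> of \<open>t\<close>, where \<open>y\<close> has weight \<open>degree y\<close>. Its
  monomials have length at most \<open>d\<close>, since weights are positive, and its second value has
  degree at most \<open>d\<close>, with its first value as the component of degree \<open>d\<close>.
\<close>

lemma leading_term_lift:
  assumes "gens t \<subseteq> Y"
  shows "\<exists>s. gens s \<subseteq> Y \<and> eval_term leading s = component d (eval_term leading t) \<and>
    eval_term (\<lambda>x. x) s \<in> degree_filtration Y d \<inter> filtration d \<and>
    component d (eval_term (\<lambda>x. x) s) = component d (eval_term leading t)"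
  (is "\<exists>s. ?R d t s")
  using assms
proof (induction t arbitrary: d)
  case (Gen y)
  show ?case
  proof (cases "component d (leading y) = 0")
    case True
    then show ?thesis by (intro exI[of _ Zero]) (simp add: subspace_0)
  next
    case False
    then have d: "d = degree y" "d \<noteq> 0" using component_0[of "leading y"] False
      by (auto simp: component_leading split: if_splits intro: gr0I)
    moreover have "y \<in> degree_filtration Y d"
      using Gen degree_filtration_base[of y Y] degree_filtration_mono[of 1 d Y] d(2) by auto
    ultimately show ?thesis
      using Gen in_filtration_degree[of y]
      by (intro exI[of _ "Gen y"]) (simp add: component_leading leading_def[symmetric])
  qed
next
  case Zero
  show ?case by (intro exI[of _ Zero]) (simp add: subspace_0)
next
  case (Add t u)
  then obtain s r where "?R d t s" "?R d u r" by fastforce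
  then show ?case by (intro exI[of _ "Add s r"]) (simp add: component_add subspace_add)
next
  case (Scale c t)
  then obtain s where "?R d t s" by fastforce
  then show ?case by (intro exI[of _ "Scale c s"]) (simp add: component_scale subspace_scale)
next
  case (Bracket t u)
  then have "\<forall>i. \<exists>s. ?R i t s" "\<forall>i. \<exists>s. ?R i u s" by simp_all
  then obtain s r where s: "\<And>i. ?R i t (s i)" and r: "\<And>i. ?R i u (r i)" by metis
  let ?q = "\<lambda>i. Bracket (s i) (r (d - i))"
  obtain q where q: "gens q \<subseteq> (\<Union>i\<le>d. gens (?q i))"
    "\<And>f. eval_term f q = (\<Sum>i\<le>d. eval_term f (?q i))"
    using eval_term_sum[of ?q d] by blast
  let ?e = "eval_term (\<lambda>x. x)"
  have mem: "?e (?q i) \<in> degree_filtration Y d \<inter> filtration d" if "i \<le> d" for i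
    using s[of i] r[of "d - i"] that degree_filtration_bracket[of _ Y i _ "d - i"]
      filtration_bracket[of _ i _ "d - i"] by auto
  have top: "component d (?e (?q i)) = bracket (component i (eval_term leading t))
      (component (d - i) (eval_term leading u))" if "i \<le> d" for i
    using s[of i] r[of "d - i"] that component_bracket_top[of "?e (s i)" i "?e (r (d - i))" "d - i"]
    by simp
  show ?case
  proof (intro exI[of _ q] conjI)
    show "gens q \<subseteq> Y" using q(1) s r by fastforce
    show "eval_term leading q = component d (eval_term leading (Bracket t u))"
      using s r by (simp add: q(2) component_bracket)
    show "?e q \<in> degree_filtration Y d \<inter> filtration d"
      unfolding q(2) using mem by (intro subspace_sum subspace_inter) auto
    show "component d (?e q) = component d (eval_term leading (Bracket t u))"
      unfolding q(2) component_of_sum using top by (simp add: component_bracket)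
  qed
qed

lemma leading_in_lie_span_lift:
  assumes "a \<in> lie_span (leading ` Y)"
  shows "\<exists>p\<in>lie_span Y \<inter> filtration d. component d p = component d a"
proof -
  obtain t where t: "gens t \<subseteq> leading ` Y" "a = eval_term (\<lambda>x. x) t"
    using lie_span_obtain_term assms by blast
  let ?u = "map_lie_term (inv_into Y leading) t"
  have inv: "inv_into Y leading x \<in> Y" "leading (inv_into Y leading x) = x" if "x \<in> gens t" for x
    using that t(1) by (auto intro: inv_into_into f_inv_into_f)
  have "gens ?u \<subseteq> Y"
    using inv(1) by (auto simp: lie_term.set_map)
  then obtain s where s: "gens s \<subseteq> Y"
    "eval_term (\<lambda>x. x) s \<in> degree_filtration Y d \<inter> filtration d"
    "component d (eval_term (\<lambda>x. x) s) = component d (eval_term leading ?u)"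
    using leading_term_lift[of ?u Y d] by blast
  have "eval_term leading ?u = eval_term (\<lambda>x. leading (inv_into Y leading x)) t"
    by (induction t) simp_all
  also have "\<dots> = a" unfolding t(2) using inv(2) by (rule eval_term_cong)
  finally show ?thesis using s degree_filtration_subset_lie_span[of Y d] by auto
qed

lemma lie_span_remove_0: "lie_span (Y - {0}) = lie_span Y"
proof (rule antisym)
  show "lie_span (Y - {0}) \<subseteq> lie_span Y" by (rule hull_mono) auto
  have "y \<in> lie_span (Y - {0})" if "y \<in> Y" for y
    using that by (cases "y = 0") (auto simp: subspace_0 intro: lie_span_base)
  then show "lie_span Y \<subseteq> lie_span (Y - {0})" by (intro lie_span_least) auto
qed

text \<open>
  If the leading component of \<open>y\<close> is generated by those of the other generators, subtracting from \<open>y\<close>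
  the same expression in the other generators lowers its degree. So a generating set with the
  smallest sum of degrees is reduced, apart from a possible \<open>0\<close>.
\<close>

lemma exists_reduced_generators:
  assumes "finite Y0"
  obtains Y where "finite Y" "lie_span Y = lie_span Y0"
    and "\<And>y. y \<in> Y \<Longrightarrow> leading y \<notin> lie_span (leading ` (Y - {y}))"
proof -
  let ?good = "\<lambda>Y. finite Y \<and> lie_span Y = lie_span Y0"
  define m where "m Y = sum degree Y" for Y
  obtain Y where Y: "?good Y" and min: "\<And>Y'. ?good Y' \<Longrightarrow> m Y \<le> m Y'"
    using arg_min_nat_lemma[of ?good Y0 m] assms by blast
  show ?thesis
  proof (rule that[of "Y - {0}"])
    show "finite (Y - {0})" "lie_span (Y - {0}) = lie_span Y0"
      using Y by (auto simp: lie_span_remove_0)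
    fix y assume y: "y \<in> Y - {0}"
    show "leading y \<notin> lie_span (leading ` (Y - {0} - {y}))"
    proof
      let ?d = "degree y" and ?Y = "Y - {y}"
      assume "leading y \<in> lie_span (leading ` (Y - {0} - {y}))"
      moreover have "lie_span (leading ` (Y - {0} - {y})) \<subseteq> lie_span (leading ` ?Y)"
        by (intro hull_mono) auto
      ultimately have "leading y \<in> lie_span (leading ` ?Y)" by blast
      from leading_in_lie_span_lift[OF this, of ?d]
      obtain p where p: "p \<in> lie_span ?Y" "p \<in> filtration ?d" "component ?d p = component ?d y"
        by (auto simp: component_leading) (simp add: leading_def)
      have d: "?d \<noteq> 0"
      proof
        assume "?d = 0"
        then have "leading y = 0" by (simp add: leading_def component_0)
        then show False using y leading_nonzero[of y] by simp
      qed
      have "component e (y - p) = 0" if "e > ?d - 1" for e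
      proof (cases "e = ?d")
        case False
        then have "e > ?d" using that d by simp
        then show ?thesis
          using p(2) in_filtration_degree[of y] by (simp add: component_diff filtration_def)
      qed (simp add: component_diff p(3))
      then have "degree (y - p) \<le> ?d - 1" by (intro degree_le) (simp add: filtration_def)
      then have less: "degree (y - p) < ?d" using d by simp
      have yp: "y - p = scale 1 y + (- p)" by simp
      have "- p \<in> lie_span (Y - {y})" using p(1) by (simp add: subspace_neg)
      then have "lie_span (insert (y - p) ?Y) = lie_span Y"
        using y by (intro lie_span_exchange[OF _ _ _ yp]) auto
      then have "m Y \<le> m (insert (y - p) ?Y)"
        using Y by (intro min) simp
      also have "\<dots> \<le> degree (y - p) + m ?Y"
        unfolding m_def using Y by (cases "y - p \<in> ?Y") (auto simp: insert_absorb)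
      also have "\<dots> < degree y + m ?Y" using less by simp
      also have "\<dots> = m Y"
        unfolding m_def using Y y sum.remove[of Y y degree] by simp
      finally show False by simp
    qed
  qed
qed

text \<open>
  For a reduced set \<open>Y\<close> no cancellation of leading components can occur. Write an element \<open>b\<close> as an
  expression in \<open>Y\<close> and let \<open>a\<close> be the value of the same expression in the leading components. As
  these satisfy no relations, \<open>f\<close> maps \<open>a\<close> to \<open>b\<close>, and \<open>b\<close> is the sum of the values of the weight
  \<open>d\<close> parts, which vanish unless \<open>component d a \<noteq> 0\<close>. For the largest such \<open>d\<close> the component of \<open>b\<close>
  of degree \<open>d\<close> is \<open>component d a\<close>, so the weights that occur are bounded by the degree of \<open>b\<close>.
\<close>

theorem exists_strict_generators:
  assumes Z0: "lie_indep Z0" "homogeneous Z0" "lie_span Z0 = UNIV" and "finite Y0"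
  obtains Y where "finite Y" "lie_span Y = lie_span Y0"
    and "\<And>n. lie_span Y0 \<inter> filtration n \<subseteq> degree_filtration Y n"
proof -
  obtain Y where Y: "finite Y" "lie_span Y = lie_span Y0"
    and red: "\<And>y. y \<in> Y \<Longrightarrow> leading y \<notin> lie_span (leading ` (Y - {y}))"
    using exists_reduced_generators[OF assms(4)] by blast
  have inj: "inj_on leading Y"
  proof (rule inj_onI, rule ccontr)
    fix y z assume yz: "y \<in> Y" "z \<in> Y" "leading y = leading z" "y \<noteq> z"
    then have "leading y \<in> leading ` (Y - {y})" by auto
    from lie_span_base[OF this] show False using red[OF yz(1)] by simp
  qed
  have "lie_indep (leading ` Y)"
  proof (rule lie_indep_homogeneous[OF Z0(1,2)])
    show "leading ` Y \<subseteq> lie_span Z0" using Z0(3) by simp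
    show "finite (leading ` Y)" using Y(1) by simp
    show "homogeneous (leading ` Y)"
      unfolding homogeneous_def by (auto simp: component_leading)
    fix h assume "h \<in> leading ` Y"
    then obtain y where y: "y \<in> Y" "h = leading y" by blast
    have "leading ` Y - {h} = leading ` (Y - {y})"
      using inj y by (auto simp: inj_on_def)
    then show "h \<notin> lie_span (leading ` Y - {h})" using red[OF y(1)] y(2) by simp
  qed
  then obtain f where f: "lie_hom_on scale bracket scale bracket (lie_span (leading ` Y)) f"
    "\<And>h. h \<in> leading ` Y \<Longrightarrow> f h = inv_into Y leading h"
    using lie_indep_extension[OF _ lie_algebra_axioms, of "leading ` Y" "inv_into Y leading"]
    by auto
  let ?e = "eval_term (\<lambda>x. x)"
  have fe: "f (eval_term leading t) = ?e t" if t: "gens t \<subseteq> Y" for t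
  proof -
    have "f (eval_term leading t) = eval_term (\<lambda>y. f (leading y)) t"
      using t by (intro hom_on_eval_term[OF lie_algebra_axioms lie_subalgebra_hull f(1)])
        (auto intro: lie_span_base)
    also have "\<dots> = ?e t"
      using t f(2) inj by (intro eval_term_cong) auto
    finally show ?thesis .
  qed
  have "b \<in> degree_filtration Y n" if b: "b \<in> lie_span Y0" "b \<in> filtration n" for b n
  proof -
    obtain t where t: "gens t \<subseteq> Y" "b = ?e t"
      using lie_span_obtain_term[of b Y] b(1) Y(2) by blast
    define a where "a = eval_term leading t"
    obtain N where N: "a \<in> filtration N" using component_eventually_zero by blast
    obtain s where s: "\<And>d. gens (s d) \<subseteq> Y" "\<And>d. eval_term leading (s d) = component d a"
      "\<And>d. ?e (s d) \<in> degree_filtration Y d" "\<And>d. ?e (s d) \<in> filtration d"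
      "\<And>d. component d (?e (s d)) = component d a"
    proof -
      have "\<forall>d. \<exists>s. gens s \<subseteq> Y \<and> eval_term leading s = component d a \<and>
          ?e s \<in> degree_filtration Y d \<inter> filtration d \<and> component d (?e s) = component d a"
        using leading_term_lift[OF t(1)] by (simp add: a_def)
      from choice[OF this] show ?thesis using that by blast
    qed
    obtain S where S: "gens S \<subseteq> (\<Union>d\<le>N. gens (s d))"
      "\<And>f. eval_term f S = (\<Sum>d\<le>N. eval_term f (s d))"
      using eval_term_sum[of s N] by blast
    have "eval_term leading S = a" using sum_component[OF N] by (simp add: S(2) s(2))
    moreover have "gens S \<subseteq> Y" using S(1) s(1) by blast
    ultimately have bs: "b = (\<Sum>d\<le>N. ?e (s d))"
      using fe[of S] fe[OF t(1)] by (simp add: S(2) a_def t(2))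
    have f0: "f 0 = 0" using fe[of Zero] by simp
    have s0: "?e (s d) = 0" if "component d a = 0" for d
      using fe[OF s(1)[of d]] that by (simp add: s(2) f0)
    have "component d a = 0" if "d > n" for d
    proof (rule ccontr)
      assume nz: "component d a \<noteq> 0"
      let ?D = "{d. component d a \<noteq> 0}"
      have D: "finite ?D"
        by (rule finite_subset[of _ "{..N}"]) (use N in \<open>auto simp: filtration_def not_le[symmetric]\<close>)
      define k where "k = Max ?D"
      have k: "component k a \<noteq> 0" "k \<ge> d" using Max_in[OF D] Max_ge[OF D] nz by (auto simp: k_def)
      have kN: "k \<le> N" using k(1) N by (auto simp: filtration_def not_le[symmetric])
      have "component k (?e (s i)) = 0" if "i \<noteq> k" for i
      proof (cases "i < k")
        case True
        then show ?thesis using s(4)[of i] by (simp add: filtration_def)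
      next
        case False
        then have "component i a = 0" using Max_ge[OF D, of i] that by (auto simp: k_def)
        then show ?thesis using s0 by simp
      qed
      then have "component k b = (\<Sum>i\<in>{k}. component k (?e (s i)))"
        unfolding bs component_of_sum using kN by (intro sum.mono_neutral_right) auto
      then have "component k b \<noteq> 0" using k(1) s(5) by simp
      then show False using b(2) k(2) that by (auto simp: filtration_def)
    qed
    then have "?e (s d) \<in> degree_filtration Y n" for d
      using s0[of d] s(3)[of d] degree_filtration_mono[of d n Y]
      by (cases "d \<le> n") (auto simp: subspace_0 not_le)
    then show ?thesis unfolding bs by (intro subspace_sum) auto
  qed
  with that Y show ?thesis by blast
qed

end

section \<open>The grading of a free Lie algebra\<close>

text \<open>
  The summands at \<open>i\<close> and \<open>n - i\<close> cancel and a middle one is zero. Stripping the two outer summands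
  in each induction step never halves a sum, so the argument is valid in characteristic two.
\<close>

lemma sum_antisymmetric_antidiagonal:
  fixes a :: "nat \<Rightarrow> nat \<Rightarrow> 'a::ab_group_add"
  assumes "\<And>i j. a j i = - a i j" and "\<And>i. a i i = 0"
  shows "(\<Sum>i\<le>n. a i (n - i)) = 0"
  using assms
proof (induction n arbitrary: a rule: nat_induct2)
  case 0
  show ?case using "0.prems"(2)[of 0] by simp
next
  case 1
  show ?case using "1.prems"(1)[of 1 0] by simp
next
  case (step n)
  have "(\<Sum>i\<le>n. a (Suc i) (Suc (n - i))) = 0"
    by (rule step.IH[of "\<lambda>i j. a (Suc i) (Suc j)"]) (rule step.prems)+
  moreover have "(\<Sum>i\<le>n. a (Suc i) (Suc n - i)) = (\<Sum>i\<le>n. a (Suc i) (Suc (n - i)))"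
    by (intro sum.cong) (auto simp: Suc_diff_le)
  moreover have "(\<Sum>i\<le>n + 2. a i (n + 2 - i))
      = a 0 (n + 2) + (\<Sum>i\<le>n. a (Suc i) (Suc n - i)) + a (n + 2) 0"
    by (simp add: sum.atMost_Suc_shift[of _ "Suc n"] del: sum.atMost_Suc) simp
  ultimately show ?case using step.prems(1)[of "n + 2" 0] by simp
qed

context lie_algebra
begin

text \<open>
  Formal power series in one variable with coefficients in the Lie algebra, written as coefficient
  sequences. The homomorphism that multiplies each free generator by the variable has
  the homogeneous components of an element as coefficients.
\<close>

lemma convolution_lie_algebra:
  "lie_algebra (\<lambda>c f n. scale c (f n))
    (\<lambda>f g n::nat. \<Sum>i\<le>n. bracket (f i) (g (n - i)))"
proof (unfold_locales, goal_cases)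
  case (9 f)
  have "(\<Sum>i\<le>n. bracket (f i) (f (n - i))) = 0" for n
    by (rule sum_antisymmetric_antidiagonal[of "\<lambda>i j. bracket (f i) (f j)"])
      (rule bracket_anticommute, rule bracket_self)
  then show ?case by (simp add: fun_eq_iff)
next
  case (10 f g h)
  have conv: "(\<Sum>i\<le>n. bracket (u i) (\<Sum>j\<le>n - i. bracket (v j) (w (n - i - j))))
      = (\<Sum>(i, j, k)\<in>{(i, j, k). i + j + k = n}. bracket (u i) (bracket (v j) (w k)))"
    for u v w :: "nat \<Rightarrow> 'a" and n
    unfolding bracket_sum_right
    by (subst sum.Sigma) (auto intro!: sum.reindex_bij_witness
        [of _ "\<lambda>(i, j, k). (i, j)" "\<lambda>(i, j). (i, j, n - i - j)"])
  have rot1: "(\<Sum>(i, j, k)\<in>{(i, j, k). i + j + k = n}. bracket (g i) (bracket (h j) (f k)))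
      = (\<Sum>(i, j, k)\<in>{(i, j, k). i + j + k = n}. bracket (g j) (bracket (h k) (f i)))" for n
    by (rule sum.reindex_bij_witness[of _ "\<lambda>(i, j, k). (j, k, i)" "\<lambda>(j, k, i). (i, j, k)"]) auto
  have rot2: "(\<Sum>(i, j, k)\<in>{(i, j, k). i + j + k = n}. bracket (h i) (bracket (f j) (g k)))
      = (\<Sum>(i, j, k)\<in>{(i, j, k). i + j + k = n}. bracket (h k) (bracket (f i) (g j)))" for n
    by (rule sum.reindex_bij_witness[of _ "\<lambda>(i, j, k). (k, i, j)" "\<lambda>(k, i, j). (i, j, k)"]) auto
  show ?case
    unfolding fun_eq_iff plus_fun_apply conv rot1 rot2
    by (simp add: sum.distrib[symmetric] case_prod_unfold jacobi)
qed (simp_all add: fun_eq_iff scale_right_distrib scale_left_distrib bracket_add_left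
    bracket_add_right bracket_scale_left bracket_scale_right sum.distrib scale_sum_right)

lemma lie_monomial_pos: "lie_monomial X k a \<Longrightarrow> k > 0"
  by (induction rule: lie_monomial.induct) auto

lemma finite_lie_monomials:
  assumes "finite X" shows "finite {a. lie_monomial X k a}"
proof (induction k rule: less_induct)
  case (less k)
  have "{a. lie_monomial X k a} \<subseteq> X \<union>
      (\<Union>m\<in>{0<..<k}. (\<lambda>(a, b). bracket a b) ` ({a. lie_monomial X m a} \<times> {a. lie_monomial X (k - m) a}))"
    (is "_ \<subseteq> X \<union> ?R")
  proof clarify
    fix a assume a: "lie_monomial X k a" "a \<notin> ?R"
    from a(1) show "a \<in> X"
    proof cases
      case (comm m u n v)
      then have "m \<in> {0<..<k}" "(u, v) \<in> {a. lie_monomial X m a} \<times> {a. lie_monomial X (k - m) a}"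
        using lie_monomial_pos[OF comm(3)] lie_monomial_pos[OF comm(4)] by auto
      with a(2) comm(2) show ?thesis by blast
    qed
  qed
  moreover have "finite (X \<union> ?R)"
    using assms less.IH by (intro finite_UnI finite_UN_I finite_imageI finite_cartesian_product) auto
  ultimately show ?case by (rule finite_subset)
qed

lemma span_lie_monomials:
  assumes "lie_span X = UNIV" shows "span {a. \<exists>k. lie_monomial X k a} = UNIV"
proof -
  have "a \<in> span {a. \<exists>k. lie_monomial X k a}" for a
  proof -
    obtain n where "a \<in> degree_filtration X n"
      using lie_span_degree_filtration[of a X] assms by auto
    then show ?thesis
      unfolding degree_filtration_def by (rule subsetD[OF span_mono, rotated]) blast
  qed
  then show ?thesis by blast
qed

theorem free_grading:
  assumes X: "lie_indep X" "lie_span X = UNIV" "finite X"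
  obtains component where "graded_lie_algebra scale bracket component"
    and "\<And>k a d. lie_monomial X k a \<Longrightarrow> component d a = (if d = k then a else 0)"
proof -
  let ?s = "\<lambda>c f n. scale c (f n)" and ?b = "\<lambda>f g n::nat. \<Sum>i\<le>n. bracket (f i) (g (n - i))"
  obtain h where h: "lie_hom_on scale bracket ?s ?b UNIV h"
    and hX: "\<And>x. x \<in> X \<Longrightarrow> h x = (\<lambda>n. if n = 1 then x else 0)"
    using lie_indep_extension[OF X(1) convolution_lie_algebra, of "\<lambda>x n. if n = 1 then x else 0"]
    unfolding X(2) by blast
  define component where "component d a = h a d" for d a
  have add: "component d (x + y) = component d x + component d y" for d x y
    using lie_hom_on_add[OF h, of x y] by (simp add: component_def)
  have scl: "component d (scale c x) = scale c (component d x)" for d c x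
    using lie_hom_on_scale[OF h, of x c] by (simp add: component_def)
  have br: "component d (bracket x y) = (\<Sum>i\<le>d. bracket (component i x) (component (d - i) y))" for d x y
    using lie_hom_on_bracket[OF h, of x y] by (simp add: component_def)
  have zero: "component d 0 = 0" for d using add[of d 0 0] by simp
  have mon: "component d a = (if d = k then a else 0)" if "lie_monomial X k a" for k a d
    using that
  proof (induction arbitrary: d rule: lie_monomial.induct)
    case (gen x)
    then show ?case by (simp add: component_def hX)
  next
    case (comm m a n b)
    have "component d (bracket a b) = (\<Sum>i\<le>d. if i = m then (if d - m = n then bracket a b else 0) else 0)"
      unfolding br by (intro sum.cong) (auto simp: comm.IH)
    also have "\<dots> = (if d = m + n then bracket a b else 0)"
      by auto
    finally show ?case .
  qed
  have ind: "Q x" if "Q 0" "\<And>c k v w. lie_monomial X k v \<Longrightarrow> Q w \<Longrightarrow> Q (scale c v + w)" for Q x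
  proof -
    have "x \<in> span {a. \<exists>k. lie_monomial X k a}" using span_lie_monomials[OF X(2)] by simp
    then show ?thesis using that by (induction x rule: span_induct_alt) blast+
  qed
  have "graded_lie_algebra scale bracket component"
  proof (unfold_locales, goal_cases)
    case (1 d x y) show ?case by (rule add)
  next
    case (2 d c x) show ?case by (rule scl)
  next
    case (3 d x y) show ?case by (rule br)
  next
    case (4 d e x)
    show ?case by (induction x rule: ind) (simp_all add: zero add scl mon)
  next
    case (5 x)
    show ?case
    proof (induction x rule: ind)
      case (2 c k v w)
      then show ?case using lie_monomial_pos[OF 2(1)] by (simp add: add scl mon[OF 2(1)])
    qed (rule zero)
  next
    case (6 x)
    have "\<exists>N. \<forall>M\<ge>N. x = (\<Sum>d\<le>M. component d x)"
    proof (induction x rule: ind)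
      case 1
      show ?case by (simp add: zero)
    next
      case (2 c k v w)
      then obtain N where N: "\<And>M. M \<ge> N \<Longrightarrow> w = (\<Sum>d\<le>M. component d w)" by blast
      have "scale c v + w = (\<Sum>d\<le>M. component d (scale c v + w))" if "M \<ge> max N k" for M
      proof -
        have "(\<Sum>d\<le>M. component d v) = v"
          unfolding mon[OF 2(1)] using that by simp
        then show ?thesis
          using N[of M] that by (simp add: add scl sum.distrib flip: scale_sum_right)
      qed
      then show ?case by blast
    qed
    then show ?case by blast
  next
    case (7 d)
    have "component d x \<in> span {a. lie_monomial X d a}" for x
    proof (induction x rule: ind)
      case 1
      show ?case by (simp add: zero span_zero)
    next
      case (2 c k v w)
      then have "component d v \<in> span {a. lie_monomial X d a}"
        by (auto simp: mon span_zero intro: span_base)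
      then show ?case unfolding add scl by (intro span_add span_scale 2)
    qed
    then show ?case using finite_lie_monomials[OF X(3)] by blast
  qed
  then show ?thesis using mon that by blast
qed

lemma finite_gens: "finite (gens t)"
  by (induction t) auto

text \<open>
  Finitely many free generators occur in expressions for the elements of a finite generating set.
\<close>

lemma finite_free_generators:
  assumes "lie_indep X" "lie_span X = UNIV" "finitely_generated UNIV"
  obtains X0 where "finite X0" "lie_indep X0" "lie_span X0 = UNIV"
proof -
  obtain Y where Y: "finite Y" "lie_span Y = UNIV"
    using assms(3) by (auto simp: finitely_generated_def generates_def)
  have "\<forall>y\<in>Y. \<exists>t. gens t \<subseteq> X \<and> eval_term (\<lambda>x. x) t = y"
    using lie_span_obtain_term[of _ X] assms(2) by simp
  from bchoice[OF this] obtain t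
    where t: "\<And>y. y \<in> Y \<Longrightarrow> gens (t y) \<subseteq> X \<and> eval_term (\<lambda>x. x) (t y) = y" by blast
  let ?X0 = "\<Union>y\<in>Y. gens (t y)"
  show ?thesis
  proof
    show "finite ?X0" using Y(1) finite_gens by blast
    show "lie_indep ?X0" by (rule lie_indep_mono[OF assms(1)]) (use t in blast)
    have "Y \<subseteq> lie_span ?X0"
    proof
      fix y assume y: "y \<in> Y"
      have "eval_term (\<lambda>x. x) (t y) \<in> lie_span ?X0"
        by (rule eval_term_in_lie_span) (use y in blast)
      then show "y \<in> lie_span ?X0" using t[OF y] by simp
    qed
    then have "lie_span Y \<subseteq> lie_span ?X0" by (rule lie_span_least)
    then show "lie_span ?X0 = UNIV" using Y(2) by blast
  qed
qed

end

section \<open>Finitely generated subalgebras are undistorted\<close>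

theorem theorem5:
  fixes scale :: "'f::field \<Rightarrow> 'a::ab_group_add \<Rightarrow> 'a"
    and bracket :: "'a \<Rightarrow> 'a \<Rightarrow> 'a"
    and B :: "'a set"
  assumes "lie_algebra scale bracket"
    and "lie_algebra.free_lie_algebra scale bracket"
    and "lie_algebra.finitely_generated scale bracket UNIV"
    and "lie_algebra.lie_subalgebra scale bracket B"
    and "lie_algebra.finitely_generated scale bracket B"
  shows "lie_algebra.undistorted scale bracket B"
proof -
  interpret lie_algebra scale bracket by fact
  obtain X where X: "lie_indep X" "lie_span X = UNIV" "finite X"
    using assms(2,3) finite_free_generators unfolding free_lie_algebra_def free_on_iff by metis
  obtain component where "graded_lie_algebra scale bracket component"
    and mon: "\<And>k a d. lie_monomial X k a \<Longrightarrow> component d a = (if d = k then a else 0)"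
    using free_grading[OF X] by blast
  then interpret graded_lie_algebra scale bracket component by simp
  have "homogeneous X"
    unfolding homogeneous_def using mon[OF lie_monomial.gen] by (metis (full_types))
  moreover obtain Y0 where Y0: "finite Y0" "lie_span Y0 = B"
    using assms(5) by (auto simp: finitely_generated_def generates_def)
  ultimately obtain Y where Y: "finite Y" "lie_span Y = B"
    "\<And>n. B \<inter> filtration n \<subseteq> degree_filtration Y n"
    using exists_strict_generators[OF X(1) _ X(2) Y0(1)] by metis
  have X_filtration: "degree_filtration X n \<subseteq> filtration n" for n
    unfolding degree_filtration_def
    by (rule span_minimal[OF _ subspace_filtration]) (auto simp: filtration_def mon)
  \<comment> \<open>The bounds for \<open>X\<close> and \<open>Y\<close> carry over to all finite generating sets.\<close>
  have "\<exists>t>0. \<forall>n. degree_filtration Y' n \<subseteq> degree_filtration X' (t * n) \<and>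
      B \<inter> degree_filtration X' n \<subseteq> degree_filtration Y' (t * n)"
    if X': "finite X'" "generates X' UNIV" and Y': "finite Y'" "generates Y' B" for X' Y'
  proof -
    obtain c1 where c1: "\<And>n. degree_filtration Y' n \<subseteq> degree_filtration X' (c1 * n)"
      using degree_filtration_compare[OF Y'(1), of X'] X'(2) by (auto simp: generates_def)
    obtain c2 where c2: "\<And>n. degree_filtration X' n \<subseteq> degree_filtration X (c2 * n)"
      using degree_filtration_compare[OF X'(1), of X] X(2) by auto
    have "Y \<subseteq> lie_span Y'" using Y(2) Y'(2) lie_span_base by (auto simp: generates_def)
    then obtain c3 where c3: "\<And>n. degree_filtration Y n \<subseteq> degree_filtration Y' (c3 * n)"
      using degree_filtration_compare[OF Y(1)] by blast
    let ?t = "Suc (c1 + c3 * c2)"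
    have "degree_filtration Y' n \<subseteq> degree_filtration X' (?t * n)" for n
      using c1[of n] degree_filtration_mono[of "c1 * n" "?t * n" X']
      by (auto simp: algebra_simps)
    moreover have "B \<inter> degree_filtration X' n \<subseteq> degree_filtration Y' (?t * n)" for n
    proof -
      have "B \<inter> degree_filtration X' n \<subseteq> B \<inter> filtration (c2 * n)"
        using c2[of n] X_filtration[of "c2 * n"] by blast
      also have "\<dots> \<subseteq> degree_filtration Y (c2 * n)" by (rule Y(3))
      also have "\<dots> \<subseteq> degree_filtration Y' (c3 * (c2 * n))" by (rule c3)
      also have "\<dots> \<subseteq> degree_filtration Y' (?t * n)"
        by (rule degree_filtration_mono) (simp add: algebra_simps)
      finally show ?thesis .
    qed
    ultimately show ?thesis by (intro exI[of _ ?t]) simp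
  qed
  then show ?thesis using assms(3-5) unfolding undistorted_def by blast
qed

end
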